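(* Assume Ostaszewski's $\clubsuit$-principle. Then $CA^\rho$ holds: (i) for every $n\geq2$ and every good type $\tau=\langle m_k,n_{k+1},r_{k+1}\rangle_{k\in\omega}$ with $n_k\geq n$ for all $k\geq1$, there is an $n$-$\rho$-capturing construction scheme of type $\tau$ over $\omega_1$; and (ii) for every good type $\tau$ for which $\langle n_{k+1}\rangle_{k\in\omega}$ is non-decreasing and unbounded, there is a $\rho$-capturing construction scheme of type $\tau$ over $\omega_1$.
   Context: $\clubsuit$: there is a sequence $\langle C_\delta:\delta\in\mathrm{Lim}\rangle$ ($\mathrm{Lim}$ = nonzero countable limit ordinals) with $C_\delta\subseteq\delta$ of order type $\omega$, $\sup C_\delta=\delta$, such that for every uncountable $S\subseteq\omega_1$ the set $\{\delta:C_\delta\subseteq S\}$ is stationary. A type is a sequence $\tau=\langle m_k,n_{k+1},r_{k+1}\rangle_{k\in\omega}$ of natural numbers with $m_0=1$ and, for all $k$, $n_{k+1}\geq2$, $m_k>r_{k+1}$, $m_{k+1}=r_{k+1}+(m_k-r_{k+1})n_{k+1}$; it is good if every $r\in\omega$ equals $r_k$ for infinitely many $k\geq1$. $A<B$ means every element of $A$ is below every element of $B$; $D(a)$ is the $a$-th element of a finite set of ordinals $D$. A construction scheme of type $\tau$ over a set of ordinals $Y$ is a family $\mathcal{F}$ of nonempty finite subsets of $Y$, cofinal among finite subsets of $Y$ under $\subseteq$, each member of size $m_k$ for some $k$, such that with $\mathcal{F}_k=\{F\in\mathcal{F}:|F|=m_k\}$: (i) for $E,F\in\mathcal{F}_k$,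 $E\cap F$ is an initial segment of both; (ii) every $F\in\mathcal{F}_{k+1}$ equals $F_0\cup\dots\cup F_{n_{k+1}-1}$ with $F_i\in\mathcal{F}_k$ a $\Delta$-system with root $R(F)$, $|R(F)|=r_{k+1}$, $R(F)<F_0\setminus R(F)<\dots<F_{n_{k+1}-1}\setminus R(F)$ (unique decomposition). $\rho(\alpha,\beta)=\min\{k:\exists F\in\mathcal{F}_k\ \{\alpha,\beta\}\subseteq F\}$. For $k\geq1$, $\Xi_\alpha(k)=-1$ if $\alpha\in R(F)$, $=i$ if $\alpha\in F_i\setminus R(F)$, for any $F\in\mathcal{F}_k$ with $\alpha\in F$ (independent of $F$). A root-tail-tail $\Delta$-system is a sequence $\langle D_i\rangle_{i<n}$, $n\geq2$, of finite sets of ordinals of common size $m$ with pairwise intersections $R$, $R<D_i\setminus R$, and $D_0\setminus R<\dots<D_{n-1}\setminus R$; $r=|R|$. It is $\rho$-captured at level $l\geq1$ if $n\leq n_l$ and (I) for all $i<n$, $a<m$: $\Xi_{D_i(a)}(l)=-1$ if $a<r$ and $=i$ if $a\geq r$; (II) $\rho(D_i(a),D_j(a))=l$ for $i<j<n$, $r\leq a<m$. A scheme over $\omega_1$ is $n$-$\rho$-capturing if for every uncountable family $\mathcal{S}$ of nonempty finite subsets of $\omega_1$ there are infinitely many $l$ for which some $n$ distinct members of $\mathcal{S}$, suitably enumerated, form a root-tail-tail $\Delta$-system $\rho$-captured at level $l$; it is $\rho$-capturing if it is $n$-$\rho$-capturing for all $n\geq2$. *)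

theory Defs
  imports Main "HOL-Library.Countable_Set"
begin

text \<open>A well-ordered type is omega_1-like if it is uncountable while every proper
initial segment is countable; any such type is order-isomorphic to omega_1.\<close>
definition omega1_like :: "'a::wellorder itself \<Rightarrow> bool" where
  "omega1_like _ \<longleftrightarrow> \<not> countable (UNIV :: 'a set) \<and> (\<forall>x::'a. countable {y. y < x})"

definition is_lim :: "'a::wellorder \<Rightarrow> bool" where
  "is_lim \<delta> \<longleftrightarrow> (\<exists>\<beta>. \<beta> < \<delta>) \<and> (\<forall>\<beta><\<delta>. \<exists>\<gamma>. \<beta> < \<gamma> \<and> \<gamma> < \<delta>)"

definition club :: "'a::wellorder set \<Rightarrow> bool" where
  "club C \<longleftrightarrow> (\<forall>\<beta>. \<exists>\<gamma>\<in>C. \<beta> < \<gamma>) \<and>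
     (\<forall>\<delta>. is_lim \<delta> \<and> (\<forall>\<beta><\<delta>. \<exists>\<gamma>\<in>C. \<beta> < \<gamma> \<and> \<gamma> < \<delta>) \<longrightarrow> \<delta> \<in> C)"

definition stationary :: "'a::wellorder set \<Rightarrow> bool" where
  "stationary S \<longleftrightarrow> (\<forall>C. club C \<longrightarrow> S \<inter> C \<noteq> {})"

definition order_type_omega :: "'a::wellorder set \<Rightarrow> bool" where
  "order_type_omega C \<longleftrightarrow> infinite C \<and> (\<forall>x\<in>C. finite {y\<in>C. y < x})"

definition clubsuit :: "'a::wellorder itself \<Rightarrow> bool" where
  "clubsuit _ \<longleftrightarrow> (\<exists>Cs :: 'a \<Rightarrow> 'a set.
     (\<forall>\<delta>. is_lim \<delta> \<longrightarrow> Cs \<delta> \<subseteq> {\<beta>. \<beta> < \<delta>} \<and> order_type_omega (Cs \<delta>) \<and>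
                       (\<forall>\<beta><\<delta>. \<exists>\<gamma>\<in>Cs \<delta>. \<beta> \<le> \<gamma>)) \<and>
     (\<forall>S :: 'a set. \<not> countable S \<longrightarrow> stationary {\<delta>. is_lim \<delta> \<and> Cs \<delta> \<subseteq> S}))"

text \<open>A type is given by three sequences m, n, r; only n (k+1), r (k+1) are used.\<close>
definition is_type :: "(nat \<Rightarrow> nat) \<Rightarrow> (nat \<Rightarrow> nat) \<Rightarrow> (nat \<Rightarrow> nat) \<Rightarrow> bool" where
  "is_type m n r \<longleftrightarrow> m 0 = 1 \<and>
     (\<forall>k. n (Suc k) \<ge> 2 \<and> m k > r (Suc k) \<and>
          m (Suc k) = r (Suc k) + (m k - r (Suc k)) * n (Suc k))"

definition good_type :: "(nat \<Rightarrow> nat) \<Rightarrow> (nat \<Rightarrow> nat) \<Rightarrow> (nat \<Rightarrow> nat) \<Rightarrow> bool" where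
  "good_type m n r \<longleftrightarrow> is_type m n r \<and> (\<forall>x. infinite {k. k \<ge> 1 \<and> r k = x})"

definition setless :: "'a::linorder set \<Rightarrow> 'a set \<Rightarrow> bool" where
  "setless A B \<longleftrightarrow> (\<forall>x\<in>A. \<forall>y\<in>B. x < y)"

definition elem :: "'a::linorder set \<Rightarrow> nat \<Rightarrow> 'a" where
  "elem D a = sorted_list_of_set D ! a"

definition init_seg :: "'a::linorder set \<Rightarrow> 'a set \<Rightarrow> bool" where
  "init_seg A F \<longleftrightarrow> A \<subseteq> F \<and> (\<forall>x\<in>A. \<forall>y\<in>F. y < x \<longrightarrow> y \<in> A)"

definition level :: "(nat \<Rightarrow> nat) \<Rightarrow> 'a set set \<Rightarrow> nat \<Rightarrow> 'a set set" where
  "level m \<F> k = {F\<in>\<F>. card F = m k}"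

definition decomp :: "(nat \<Rightarrow> nat) \<Rightarrow> (nat \<Rightarrow> nat) \<Rightarrow> (nat \<Rightarrow> nat) \<Rightarrow> 'a::linorder set set \<Rightarrow>
    nat \<Rightarrow> 'a set \<Rightarrow> 'a set \<Rightarrow> (nat \<Rightarrow> 'a set) \<Rightarrow> bool" where
  "decomp m n r \<F> k F R Fs \<longleftrightarrow>
     F = (\<Union>i<n (Suc k). Fs i) \<and>
     (\<forall>i<n (Suc k). Fs i \<in> level m \<F> k) \<and>
     (\<forall>i<n (Suc k). \<forall>j<n (Suc k). i \<noteq> j \<longrightarrow> Fs i \<inter> Fs j = R) \<and>
     card R = r (Suc k) \<and>
     setless R (Fs 0 - R) \<and>
     (\<forall>i. Suc i < n (Suc k) \<longrightarrow> setless (Fs i - R) (Fs (Suc i) - R))"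

definition construction_scheme :: "(nat \<Rightarrow> nat) \<Rightarrow> (nat \<Rightarrow> nat) \<Rightarrow> (nat \<Rightarrow> nat) \<Rightarrow>
    'a::linorder set \<Rightarrow> 'a set set \<Rightarrow> bool" where
  "construction_scheme m n r Y \<F> \<longleftrightarrow>
     (\<forall>F\<in>\<F>. F \<noteq> {} \<and> finite F \<and> F \<subseteq> Y \<and> (\<exists>k. card F = m k)) \<and>
     (\<forall>A. finite A \<and> A \<subseteq> Y \<longrightarrow> (\<exists>F\<in>\<F>. A \<subseteq> F)) \<and>
     (\<forall>k. \<forall>E\<in>level m \<F> k. \<forall>F\<in>level m \<F> k. init_seg (E \<inter> F) E \<and> init_seg (E \<inter> F) F) \<and>
     (\<forall>k. \<forall>F\<in>level m \<F> (Suc k). \<exists>R Fs. decomp m n r \<F> k F R Fs)"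

definition rho :: "(nat \<Rightarrow> nat) \<Rightarrow> 'a set set \<Rightarrow> 'a \<Rightarrow> 'a \<Rightarrow> nat" where
  "rho m \<F> \<alpha> \<beta> = (LEAST k. \<exists>F\<in>level m \<F> k. {\<alpha>, \<beta>} \<subseteq> F)"

text \<open>Xi_alpha(k) = i (for k \<ge> 1), with -1 encoding membership in the root; witnessed by
some F of level k containing alpha (the paper shows the value is independent of F).\<close>
definition Xi_is :: "(nat \<Rightarrow> nat) \<Rightarrow> (nat \<Rightarrow> nat) \<Rightarrow> (nat \<Rightarrow> nat) \<Rightarrow> 'a::linorder set set \<Rightarrow>
    'a \<Rightarrow> nat \<Rightarrow> int \<Rightarrow> bool" where
  "Xi_is m n r \<F> \<alpha> k i \<longleftrightarrow> k \<ge> 1 \<and>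
     (\<exists>F\<in>level m \<F> k. \<exists>R Fs. decomp m n r \<F> (k - 1) F R Fs \<and> \<alpha> \<in> F \<and>
        ((\<alpha> \<in> R \<and> i = -1) \<or> (\<alpha> \<notin> R \<and> i \<ge> 0 \<and> \<alpha> \<in> Fs (nat i))))"

definition rtt_delta :: "(nat \<Rightarrow> 'a::linorder set) \<Rightarrow> nat \<Rightarrow> nat \<Rightarrow> 'a set \<Rightarrow> bool" where
  "rtt_delta D len msz R \<longleftrightarrow> len \<ge> 2 \<and>
     (\<forall>i<len. finite (D i) \<and> card (D i) = msz) \<and>
     (\<forall>i<len. \<forall>j<len. i \<noteq> j \<longrightarrow> D i \<inter> D j = R) \<and>
     (\<forall>i<len. setless R (D i - R)) \<and>
     (\<forall>i. Suc i < len \<longrightarrow> setless (D i - R) (D (Suc i) - R))"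

definition rho_captured :: "(nat \<Rightarrow> nat) \<Rightarrow> (nat \<Rightarrow> nat) \<Rightarrow> (nat \<Rightarrow> nat) \<Rightarrow> 'a::linorder set set \<Rightarrow>
    (nat \<Rightarrow> 'a set) \<Rightarrow> nat \<Rightarrow> nat \<Rightarrow> bool" where
  "rho_captured m n r \<F> D len l \<longleftrightarrow> l \<ge> 1 \<and>
     (\<exists>msz R. rtt_delta D len msz R \<and> len \<le> n l \<and>
        (\<forall>i<len. \<forall>a<msz. Xi_is m n r \<F> (elem (D i) a) l
                              (if a < card R then -1 else int i)) \<and>
        (\<forall>i j a. i < j \<and> j < len \<and> card R \<le> a \<and> a < msz \<longrightarrow>
                 rho m \<F> (elem (D i) a) (elem (D j) a) = l))"

definition n_rho_capturing :: "nat \<Rightarrow> (nat \<Rightarrow> nat) \<Rightarrow> (nat \<Rightarrow> nat) \<Rightarrow> (nat \<Rightarrow> nat) \<Rightarrow>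
    'a::linorder set set \<Rightarrow> bool" where
  "n_rho_capturing len m n r \<F> \<longleftrightarrow>
     (\<forall>\<S>. \<not> countable \<S> \<and> (\<forall>S\<in>\<S>. S \<noteq> {} \<and> finite S) \<longrightarrow>
        infinite {l. \<exists>D. inj_on D {..<len} \<and> D ` {..<len} \<subseteq> \<S> \<and> rho_captured m n r \<F> D len l})"

definition rho_capturing :: "(nat \<Rightarrow> nat) \<Rightarrow> (nat \<Rightarrow> nat) \<Rightarrow> (nat \<Rightarrow> nat) \<Rightarrow>
    'a::linorder set set \<Rightarrow> bool" where
  "rho_capturing m n r \<F> \<longleftrightarrow> (\<forall>len\<ge>2. n_rho_capturing len m n r \<F>)"

end

theory Submission
  imports "HOL-Algebra.Free_Abelian_Groups" (* eqpoll_Fpow *) Defs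
begin

text \<open>
  A scheme is encoded by the hulls \<open>h b k = {x \<le> b. \<rho>(x, b) \<le> k}\<close>, which are built by recursion on \<open>b\<close>.
  A successor follows its predecessor at all large levels. A limit \<open>d\<close> follows points \<open>z\<^sub>0, z\<^sub>1, \<dots>\<close>
  below it: its hull is that of \<open>z\<^sub>i\<close> plus \<open>d\<close> until a level \<open>l\<close> whose root size \<open>r\<^sub>l\<close> equals the size of
  the hull of \<open>z\<^sub>i\<close>. There \<open>d\<close> may enter any piece of a level-\<open>l\<close> set whose root is this hull, and then
  follows the last point \<open>z\<^sub>i\<^sub>+\<^sub>1\<close> before it. Goodness of the type makes such levels available again and
  again, so \<open>d\<close> can meet countably many requirements.

  The principle \<open>\<clubsuit>\<close> enters through iterated guessing. For an uncountable \<open>\<Delta>\<close>-system with tails in \<open>\<W>\<close>,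
  there are unboundedly many \<open>d\<close> guessing pairs \<open>(d', W)\<close> with \<open>d' < W \<in> \<W>\<close>, where \<open>d'\<close> itself guesses such
  pairs, and so on \<open>s\<close> times. If every guessed \<open>d'\<close> lies in piece \<open>s\<close> next to a tuple of length \<open>s\<close>
  from \<open>\<W>\<close>, at levels and over roots that later points can still reach, then \<open>d\<close> can be placed in
  piece \<open>s + 1\<close>. Everything above \<open>d\<close> is in the same piece as \<open>d\<close> at all large levels, so any tail above
  \<open>d\<close> completes a \<open>\<rho>\<close>-captured tuple.
\<close>

section \<open>Order-theoretic preliminaries\<close>

lemma mono_unbounded_MOST_le:
  fixes f :: "nat \<Rightarrow> nat"
  assumes "mono f" "\<forall>b. \<exists>k. f k > b"
  shows "\<forall>\<^sub>\<infinity>k. b \<le> f k"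
proof -
  obtain j where "b < f j"
    using assms(2) by blast
  then have "\<forall>k\<ge>j. b \<le> f k"
    using monoD[OF assms(1), of j] by fastforce
  then show ?thesis
    unfolding MOST_nat_le by blast
qed

lemma strict_mono_interval:
  fixes l :: "nat \<Rightarrow> nat"
  assumes l: "strict_mono l" and "l 0 < k"
  shows "\<exists>!i. l i < k \<and> k \<le> l (Suc i)"
proof (rule ex_ex1I)
  define i where "i = (LEAST i. k \<le> l (Suc i))"
  have "k \<le> l (Suc k)"
    using strict_mono_imp_increasing[OF l, of "Suc k"] by simp
  then have "k \<le> l (Suc i)"
    unfolding i_def by (rule LeastI)
  moreover have "l i < k"
    using \<open>l 0 < k\<close> not_less_Least[of "i - 1" "\<lambda>i. k \<le> l (Suc i)"]
    by (cases i) (auto simp flip: i_def)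
  ultimately show "\<exists>i. l i < k \<and> k \<le> l (Suc i)"
    by blast
next
  fix i j assume i: "l i < k \<and> k \<le> l (Suc i)" and j: "l j < k \<and> k \<le> l (Suc j)"
  then have "l i < l (Suc j)" "l j < l (Suc i)"
    by auto
  then show "i = j"
    using l by (simp add: strict_mono_less)
qed

lemma piecewise_along_strict_mono:
  fixes l :: "nat \<Rightarrow> nat"
  assumes l: "strict_mono l"
  shows "\<exists>A. \<forall>i k. l i < k \<and> k \<le> l (Suc i) \<longrightarrow> A k = f i k"
proof -
  define A where "A k = f (THE i. l i < k \<and> k \<le> l (Suc i)) k" for k
  have "A k = f i k" if i: "l i < k \<and> k \<le> l (Suc i)" for i k
  proof -
    have "l 0 \<le> l i"
      using l by (simp add: strict_mono_less_eq)
    then have "l 0 < k"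
      using i by simp
    from the1_equality[OF strict_mono_interval[OF l this] i] show ?thesis
      by (simp add: A_def)
  qed
  then show ?thesis
    by blast
qed

definition is_succ :: "'a::wellorder \<Rightarrow> 'a \<Rightarrow> bool" where
  "is_succ b c \<longleftrightarrow> b < c \<and> (\<forall>x. b < x \<longrightarrow> c \<le> x)"

lemma is_succ_exists: "b < c \<Longrightarrow> \<exists>b'. is_succ b b' \<and> b' \<le> c"
  by (intro exI[of _ "LEAST x. b < x"]) (auto simp: is_succ_def intro: LeastI Least_le)

lemma is_succ_le: "is_succ b d \<Longrightarrow> g < d \<Longrightarrow> g \<le> b"
  unfolding is_succ_def by (meson not_le)

lemma is_succ_unique: "is_succ b d \<Longrightarrow> is_succ b' d \<Longrightarrow> b = b'"
  using is_succ_le is_succ_def by (metis antisym)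

lemma is_lim_or_succ: "b < d \<Longrightarrow> is_lim d \<or> (\<exists>c. is_succ c d)"
  unfolding is_lim_def is_succ_def by (meson not_le)

lemma is_lim_imp_not_is_succ: "is_lim d \<Longrightarrow> \<not> is_succ b d"
  unfolding is_lim_def is_succ_def by (meson leD)

lemma is_lim_succ_less: "is_lim d \<Longrightarrow> b < d \<Longrightarrow> \<exists>b'. is_succ b b' \<and> b' < d"
  unfolding is_lim_def using is_succ_exists by (meson le_less_trans)

lemma is_lim_finite_bound:
  assumes lim: "is_lim d" and Z: "finite Z" "Z \<subseteq> {..<d}"
  shows "\<exists>y<d. Z \<subseteq> {..<y}"
proof -
  obtain x where "x < d"
    using lim is_lim_def by blast
  then have "Max (insert x Z) < d"
    using Z by auto
  then obtain y where "Max (insert x Z) < y" "y < d"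
    using lim is_lim_def by blast
  then show ?thesis
    using Z(1) by auto
qed

lemma sorted_list_of_set_setless_Un:
  assumes "finite A" "finite B" "setless A B"
  shows "sorted_list_of_set (A \<union> B) = sorted_list_of_set A @ sorted_list_of_set B"
proof (rule sorted_distinct_set_unique)
  show "sorted (sorted_list_of_set A @ sorted_list_of_set B)"
    using assms by (auto simp: sorted_append setless_def intro: less_imp_le)
  show "distinct (sorted_list_of_set A @ sorted_list_of_set B)"
    using assms by (auto simp: setless_def)
qed (use assms in auto)

lemma elem_setless_Un:
  assumes fin: "finite A" "finite B" and less: "setless A B" and a: "a < card A + card B"
  shows "elem (A \<union> B) a \<in> (if a < card A then A else B)"
proof -
  have elem_eq: "elem (A \<union> B) a = (sorted_list_of_set A @ sorted_list_of_set B) ! a"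
    unfolding elem_def sorted_list_of_set_setless_Un[OF fin less] ..
  have "sorted_list_of_set A ! a \<in> set (sorted_list_of_set A)" if "a < card A"
    using that by (intro nth_mem) simp
  moreover have "sorted_list_of_set B ! (a - card A) \<in> set (sorted_list_of_set B)" if "\<not> a < card A"
    using that a by (intro nth_mem) simp
  ultimately show ?thesis
    using fin by (simp add: elem_eq nth_append)
qed

lemma rtt_delta_inj_on:
  assumes D: "rtt_delta D len q R" and "card R < q"
  shows "inj_on D {..<len}"
proof (rule inj_onI, rule ccontr)
  fix i j assume ij: "i \<in> {..<len}" "j \<in> {..<len}" "D i = D j" "i \<noteq> j"
  then have "D i = R" "card (D i) = q"
    using D unfolding rtt_delta_def by auto
  then show False
    using \<open>card R < q\<close> by simp
qed

section \<open>Combinatorics of \<open>\<omega>\<^sub>1\<close>\<close>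

definition unbounded_family :: "'a::order set set \<Rightarrow> bool" where
  "unbounded_family \<W> \<longleftrightarrow> (\<forall>b. \<exists>W\<in>\<W>. W \<subseteq> {b<..})"

definition tails :: "'a::linorder set set \<Rightarrow> 'a set \<Rightarrow> nat \<Rightarrow> 'a set set" where
  "tails \<S> R q = {W. R \<union> W \<in> \<S> \<and> setless R W \<and> finite W \<and> card W = q}"

lemma unbounded_family_tails_insert:
  assumes unbounded: "unbounded_family (tails ((\<lambda>D. D - {a}) ` {D \<in> \<S>. a \<in> D}) R q)"
  shows "unbounded_family (tails \<S> (insert a R) q)"
  unfolding unbounded_family_def
proof
  fix b
  obtain W where W: "W \<in> tails ((\<lambda>D. D - {a}) ` {D \<in> \<S>. a \<in> D}) R q" "W \<subseteq> {max a b<..}"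
    using unbounded unfolding unbounded_family_def by blast
  then obtain D where D: "D \<in> \<S>" "a \<in> D" "R \<union> W = D - {a}"
    by (auto simp: tails_def)
  then have "insert a R \<union> W = D"
    by blast
  then have "W \<in> tails \<S> (insert a R) q"
    using W D(1) by (auto simp: tails_def setless_def)
  moreover have "W \<subseteq> {b<..}"
    using W(2) by auto
  ultimately show "\<exists>W\<in>tails \<S> (insert a R) q. W \<subseteq> {b<..}"
    by blast
qed

locale omega1 =
  fixes ty :: "'a::wellorder itself"
  assumes omega1: "omega1_like TYPE('a)"
begin

lemma countable_lessThan: "countable {..<x::'a}"
  using omega1 by (simp add: omega1_like_def lessThan_def)

lemma countable_atMost: "countable {..x::'a}"
proof -
  have "{..x} = insert x {..<x}"
    by auto
  then show ?thesis
    using countable_lessThan by simp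
qed

lemma countable_bounded:
  assumes "countable (A :: 'a set)"
  shows "\<exists>b. A \<subseteq> {..<b}"
proof (rule ccontr)
  assume "\<not> ?thesis"
  then have "UNIV \<subseteq> (\<Union>a\<in>A. {..a})"
    by (auto simp: subset_iff not_less)
  moreover have "countable (\<Union>a\<in>A. {..a})"
    using assms countable_atMost by blast
  ultimately show False
    using omega1 countable_subset unfolding omega1_like_def by blast
qed

lemma is_succ_total: "\<exists>y. is_succ (x::'a) y"
  using countable_bounded[of "{x}"] is_succ_exists by auto

lemma closure_point_exists:
  fixes g :: "'a \<Rightarrow> 'a"
  shows "\<exists>c>b. is_lim c \<and> (\<forall>x<c. g x < c)"
proof -
  have "\<exists>u>x. g ` {..x} \<subseteq> {..<u}" for x
    using countable_bounded[of "insert x (g ` {..x})"] countable_atMost[of x] by auto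
  then obtain F where F: "\<And>x. x < F x" "\<And>x y. y \<le> x \<Longrightarrow> g y < F x"
    by (metis atMost_iff image_subset_iff lessThan_iff)
  define s where "s i = (F ^^ i) b" for i
  obtain u where u: "range s \<subseteq> {..<u}"
    using countable_bounded[of "range s"] by auto
  define c where "c = (LEAST u. \<forall>i. s i < u)"
  have less_c: "s i < c" for i
    unfolding c_def by (rule LeastI2[of _ u]) (use u in auto)
  have below_s: "\<exists>i. x \<le> s i" if "x < c" for x
    using not_less_Least[of x "\<lambda>u. \<forall>i. s i < u"] that by (auto simp: not_less simp flip: c_def)
  have step: "x < s (Suc i)" "g x < s (Suc i)" if "x \<le> s i" for x i
    using F(2)[OF that] le_less_trans[OF that F(1)] by (auto simp: s_def)
  have "b < c"
    using less_c[of 0] by (simp add: s_def)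
  moreover have "is_lim c"
    unfolding is_lim_def using \<open>b < c\<close> below_s step(1) less_c by blast
  moreover have "g x < c" if "x < c" for x
    using below_s[OF that] step(2) less_c by (meson less_trans)
  ultimately show ?thesis
    by blast
qed

lemma club_closure_points:
  fixes g :: "'a \<Rightarrow> 'a"
  shows "club {c. is_lim c \<and> b < c \<and> (\<forall>x<c. g x < c)}"
  unfolding club_def
proof (intro conjI allI impI)
  show "\<exists>c\<in>{c. is_lim c \<and> b < c \<and> (\<forall>x<c. g x < c)}. a < c" for a
    using closure_point_exists[of "max a b" g] by auto
next
  fix d assume "is_lim d \<and> (\<forall>x<d. \<exists>c\<in>{c. is_lim c \<and> b < c \<and> (\<forall>x<c. g x < c)}. x < c \<and> c < d)"
  then have lim: "is_lim d" and below: "\<And>x. x < d \<Longrightarrow> \<exists>c. b < c \<and> (\<forall>y<c. g y < c) \<and> x < c \<and> c < d"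
    by auto
  have "g x < d" if "x < d" for x
    using below[OF that] by (meson less_trans)
  moreover have "b < d"
    using lim below unfolding is_lim_def by (meson less_trans)
  ultimately show "d \<in> {c. is_lim c \<and> b < c \<and> (\<forall>x<c. g x < c)}"
    using lim by blast
qed

lemma uncountable_unbounded_family:
  assumes \<U>: "unbounded_family (\<U> :: 'a set set)" and fin: "\<And>U. U \<in> \<U> \<Longrightarrow> finite U \<and> U \<noteq> {}"
  shows "uncountable \<U>"
proof
  assume "countable \<U>"
  then have "countable (\<Union>U\<in>\<U>. U)"
    by (rule countable_UN) (use fin in \<open>auto intro: countable_finite\<close>)
  then obtain u where u: "(\<Union>U\<in>\<U>. U) \<subseteq> {..<u}"
    using countable_bounded by blast
  obtain U where U: "U \<in> \<U>" "U \<subseteq> {u<..}"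
    using \<U> unfolding unbounded_family_def by blast
  then obtain v where "v \<in> U"
    using fin by (meson all_not_in_conv)
  then have "v < u" "u < v"
    using u U by auto
  then show False
    by simp
qed

lemma uncountable_family_through_point:
  assumes "uncountable (\<S> :: 'a set set)" "\<not> unbounded_family \<S>"
  shows "\<exists>a. uncountable {D \<in> \<S>. a \<in> D}"
proof -
  obtain b where "\<forall>D\<in>\<S>. \<not> D \<subseteq> {b<..}"
    using assms(2) by (auto simp: unbounded_family_def)
  then have "\<S> \<subseteq> (\<Union>a\<in>{..b}. {D \<in> \<S>. a \<in> D})"
    by (fastforce simp: not_less)
  then have "uncountable (\<Union>a\<in>{..b}. {D \<in> \<S>. a \<in> D})"
    using assms(1) countable_subset by blast
  then show ?thesis
    using countable_UN[OF countable_atMost, of b "\<lambda>a. {D \<in> \<S>. a \<in> D}"] by blast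
qed

lemma delta_system_card:
  assumes "uncountable (\<S> :: 'a set set)" "\<And>D. D \<in> \<S> \<Longrightarrow> finite D \<and> card D = c"
  shows "\<exists>R q. finite R \<and> q > 0 \<and> unbounded_family (tails \<S> R q)"
  using assms
proof (induction c arbitrary: \<S>)
  case 0
  then have "\<S> \<subseteq> {{}}"
    by (metis card_0_eq singleton_iff subsetI)
  then have "countable \<S>"
    by (rule countable_subset) simp
  then show ?case
    using 0(1) by simp
next
  case (Suc c)
  show ?case
  proof (cases "unbounded_family \<S>")
    case True
    then have "unbounded_family (tails \<S> {} (Suc c))"
      using Suc.prems(2) by (simp add: unbounded_family_def tails_def setless_def) blast
    then show ?thesis
      by (intro exI[of _ "{}"] exI[of _ "Suc c"]) simp
  next
    case False
    obtain a where a: "uncountable {D \<in> \<S>. a \<in> D}"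
      using uncountable_family_through_point[OF Suc.prems(1) False] ..
    let ?\<S>' = "(\<lambda>D. D - {a}) ` {D \<in> \<S>. a \<in> D}"
    have "inj_on (\<lambda>D. D - {a}) {D \<in> \<S>. a \<in> D}"
      by (rule inj_onI) blast
    then have "uncountable ?\<S>'"
      using a countable_image_inj_on by blast
    moreover have "finite D \<and> card D = c" if D: "D \<in> ?\<S>'" for D
      using D Suc.prems(2) by (elim imageE) simp
    ultimately obtain R q where R: "finite R" "q > 0" "unbounded_family (tails ?\<S>' R q)"
      using Suc.IH[of ?\<S>'] by blast
    then show ?thesis
      using unbounded_family_tails_insert by (intro exI[of _ "insert a R"] exI[of _ q]) auto
  qed
qed

lemma delta_system:
  assumes "uncountable (\<S> :: 'a set set)" "\<forall>D\<in>\<S>. finite D"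
  shows "\<exists>R q. finite R \<and> q > 0 \<and> unbounded_family (tails \<S> R q)"
proof -
  have "\<S> = (\<Union>c. {D \<in> \<S>. card D = c})"
    by auto
  then obtain c where "uncountable {D \<in> \<S>. card D = c}"
    using assms(1) countable_UN[of UNIV "\<lambda>c. {D \<in> \<S>. card D = c}"] by auto
  then have "\<exists>R q. finite R \<and> q > 0 \<and> unbounded_family (tails {D \<in> \<S>. card D = c} R q)"
    using assms(2) by (intro delta_system_card) auto
  then obtain R q where R: "finite R" "q > 0" "unbounded_family (tails {D \<in> \<S>. card D = c} R q)"
    by blast
  have "tails {D \<in> \<S>. card D = c} R q \<subseteq> tails \<S> R q"
    by (auto simp: tails_def)
  then have "unbounded_family (tails \<S> R q)"
    using R(3) unfolding unbounded_family_def by blast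
  then show ?thesis
    using R(1,2) by blast
qed

text \<open>The principle \<open>\<clubsuit>\<close> guesses families of finite sets as well: code the finite sets by ordinals.\<close>

definition guesses_finite_sets :: "('a \<Rightarrow> 'a set set) \<Rightarrow> bool" where
  "guesses_finite_sets \<D> \<longleftrightarrow>
     (\<forall>\<U> b. unbounded_family \<U> \<and> (\<forall>U\<in>\<U>. finite U \<and> U \<noteq> {}) \<longrightarrow>
       (\<exists>c>b. is_lim c \<and> \<D> c \<subseteq> \<U> \<and> (\<forall>x<c. \<exists>U\<in>\<D> c. U \<subseteq> {x<..<c})))"

lemma coded_family_bound:
  fixes e :: "'a set \<Rightarrow> 'a" and U :: "'a \<Rightarrow> 'a set"
  assumes inj: "\<And>x y. e (U x) = e (U y) \<Longrightarrow> U x = U y" and fin: "\<And>x. finite (U x)"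
  shows "\<exists>g. \<forall>y. (\<forall>x\<le>y. e (U x) < g y) \<and> (\<forall>x. e (U x) = y \<longrightarrow> U x \<subseteq> {..<g y})"
proof (intro choice allI)
  fix y
  define y' where "y' = (SOME x. e (U x) = y)"
  have "U x = U y'" if "e (U x) = y" for x
    using inj[of x y'] someI[of "\<lambda>x. e (U x) = y", OF that] that by (simp add: y'_def)
  moreover have "countable ((\<lambda>x. e (U x)) ` {..y} \<union> U y')"
    using countable_atMost fin by (simp add: countable_finite)
  then obtain u where "(\<lambda>x. e (U x)) ` {..y} \<union> U y' \<subseteq> {..<u}"
    using countable_bounded by blast
  ultimately show "\<exists>u. (\<forall>x\<le>y. e (U x) < u) \<and> (\<forall>x. e (U x) = y \<longrightarrow> U x \<subseteq> {..<u})"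
    by (intro exI[of _ u]) auto
qed

lemma clubsuit_guesses_coded_family:
  fixes e :: "'a set \<Rightarrow> 'a" and C :: "'a \<Rightarrow> 'a set"
  assumes C: "\<And>d. is_lim d \<Longrightarrow> C d \<subseteq> {..<d}" "\<And>d b. is_lim d \<Longrightarrow> b < d \<Longrightarrow> \<exists>g\<in>C d. b \<le> g"
    and guess: "\<And>X. uncountable X \<Longrightarrow> stationary {d. is_lim d \<and> C d \<subseteq> X}"
    and e: "inj_on e (Fpow UNIV)"
    and \<U>: "unbounded_family \<U>" and fin: "\<And>U. U \<in> \<U> \<Longrightarrow> finite U \<and> U \<noteq> {}"
  shows "\<exists>c>b. is_lim c \<and> {V. finite V \<and> e V \<in> C c} \<subseteq> \<U> \<and>
    (\<forall>x<c. \<exists>V. finite V \<and> e V \<in> C c \<and> V \<subseteq> {x<..<c})"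
proof -
  obtain U where U: "\<And>x. U x \<in> \<U>" "\<And>x. U x \<subseteq> {x<..}"
    using \<U> unfolding unbounded_family_def by metis
  have finU: "finite (U x)" for x
    using fin U(1) by blast
  have inj: "U x = V" if "e (U x) = e V" "finite V" for x V
    using inj_onD[OF e that(1)] finU that(2) by (simp add: Fpow_def)
  have "uncountable (range U)"
    using U fin by (intro uncountable_unbounded_family) (auto simp: unbounded_family_def)
  moreover have "inj_on e (range U)"
    using e by (rule inj_on_subset) (use finU in \<open>auto simp: Fpow_def\<close>)
  ultimately have stationary: "stationary {d. is_lim d \<and> C d \<subseteq> e ` range U}"
    using guess countable_image_inj_on by blast
  obtain g where g: "\<And>x y. x \<le> y \<Longrightarrow> e (U x) < g y" "\<And>x. U x \<subseteq> {..<g (e (U x))}"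
    using coded_family_bound[of e U, OF inj[OF _ finU] finU] by blast
  obtain c where c: "is_lim c" "C c \<subseteq> e ` range U" "b < c" "\<And>x. x < c \<Longrightarrow> g x < c"
    using stationary club_closure_points[of b g] unfolding stationary_def by blast
  have "V \<in> \<U>" if "finite V" "e V \<in> C c" for V
  proof -
    have "\<exists>x. e (U x) = e V"
      using that(2) c(2) by force
    then show ?thesis
      using inj \<open>finite V\<close> U(1) by metis
  qed
  moreover have "\<exists>V. finite V \<and> e V \<in> C c \<and> V \<subseteq> {x<..<c}" if "x < c" for x
  proof -
    obtain y where y: "e (U y) \<in> C c" "g x \<le> e (U y)"
      using C(2)[OF c(1) c(4)[OF \<open>x < c\<close>]] c(2) by auto
    have "x < y"
      using g(1)[of y x] y(2) by (meson leD not_le)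
    moreover have "g (e (U y)) < c"
      using C(1)[OF c(1)] y(1) c(4) by blast
    ultimately have "U y \<subseteq> {x<..<c}"
      using g(2)[of y] U(2)[of y] by (auto simp: subset_iff intro: less_trans)
    then show ?thesis
      using y(1) finU by blast
  qed
  ultimately show ?thesis
    using c(1,3) by blast
qed

lemma clubsuit_guesses_finite_sets:
  assumes "clubsuit TYPE('a)"
  shows "\<exists>\<D> :: 'a \<Rightarrow> 'a set set. guesses_finite_sets \<D>"
proof -
  obtain C :: "'a \<Rightarrow> 'a set"
    where C: "\<forall>d. is_lim d \<longrightarrow> C d \<subseteq> {..<d} \<and> order_type_omega (C d) \<and> (\<forall>b<d. \<exists>g\<in>C d. b \<le> g)"
      and guess: "\<forall>X. uncountable X \<longrightarrow> stationary {d. is_lim d \<and> C d \<subseteq> X}"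
    using assms unfolding clubsuit_def lessThan_def by (elim exE conjE)
  have "infinite (UNIV :: 'a set)"
    using omega1 countable_finite unfolding omega1_like_def by blast
  then obtain e :: "'a set \<Rightarrow> 'a" where e: "inj_on e (Fpow UNIV)"
    using eqpoll_Fpow unfolding eqpoll_def bij_betw_def by blast
  have "\<exists>c>b. is_lim c \<and> {V. finite V \<and> e V \<in> C c} \<subseteq> \<U> \<and>
      (\<forall>x<c. \<exists>V\<in>{V. finite V \<and> e V \<in> C c}. V \<subseteq> {x<..<c})"
    if "unbounded_family \<U>" "\<forall>U\<in>\<U>. finite U \<and> U \<noteq> {}" for \<U> b
    using clubsuit_guesses_coded_family[of C e \<U> b] C guess e that by auto
  then show ?thesis
    unfolding guesses_finite_sets_def by (intro exI[of _ "\<lambda>c. {V. finite V \<and> e V \<in> C c}"]) blast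
qed

end

section \<open>Arithmetic of a type\<close>

locale scheme_type =
  fixes m n r :: "nat \<Rightarrow> nat"
  assumes is_type: "is_type m n r"
begin

lemma root_less_m: "r (Suc k) < m k"
  and n_ge_2: "n (Suc k) \<ge> 2"
  using is_type by (auto simp: is_type_def)

definition width :: "nat \<Rightarrow> nat" where
  "width k = m k - r (Suc k)"

lemma width_pos: "width k > 0"
  and m_eq_root_width: "m k = r (Suc k) + width k"
  using root_less_m[of k] by (auto simp: width_def)

lemma m_Suc: "m (Suc k) = r (Suc k) + n (Suc k) * width k"
  using is_type by (auto simp: is_type_def width_def)

lemma m_less_Suc: "m k < m (Suc k)"
proof -
  have "2 * width k \<le> n (Suc k) * width k"
    using n_ge_2[of k] by simp
  then show ?thesis
    using m_eq_root_width[of k] m_Suc[of k] width_pos[of k] by simp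
qed

lemma strict_mono_m: "strict_mono m"
  using m_less_Suc by (simp add: strict_mono_Suc_iff)

text \<open>The elements of a level-\<open>k + 1\<close> set are ranked from 1. The block of a rank is 0 for the root and
  \<open>i + 1\<close> for the piece \<open>F\<^sub>i\<close>; its projection is the rank within the level-\<open>k\<close> set \<open>F\<^sub>i\<close>.\<close>

definition block :: "nat \<Rightarrow> nat \<Rightarrow> nat" where
  "block k q = (if q \<le> r (Suc k) then 0 else Suc ((q - Suc (r (Suc k))) div width k))"

definition proj :: "nat \<Rightarrow> nat \<Rightarrow> nat" where
  "proj k q = q - (block k q - 1) * width k"

lemma block_eq_0_iff: "block k q = 0 \<longleftrightarrow> q \<le> r (Suc k)"
  by (simp add: block_def)

lemma block_eq_Suc_iff:
  "block k q = Suc i \<longleftrightarrow> r (Suc k) + i * width k < q \<and> q \<le> r (Suc k) + Suc i * width k"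
proof (cases "q \<le> r (Suc k)")
  case False
  define p where "p = q - Suc (r (Suc k))"
  have q: "q = Suc (r (Suc k) + p)"
    using False by (simp add: p_def)
  have "block k q = Suc i \<longleftrightarrow> p div width k = i"
    using False by (simp add: block_def p_def)
  also have "\<dots> \<longleftrightarrow> i \<le> p div width k \<and> p div width k < Suc i"
    by auto
  also have "\<dots> \<longleftrightarrow> i * width k \<le> p \<and> p < Suc i * width k"
    using width_pos[of k] by (simp only: less_eq_div_iff_mult_less_eq div_less_iff_less_mult)
  also have "\<dots> \<longleftrightarrow> r (Suc k) + i * width k < q \<and> q \<le> r (Suc k) + Suc i * width k"
    unfolding q by auto
  finally show ?thesis .
qed (simp add: block_def)

lemma block_mono: "p \<le> q \<Longrightarrow> block k p \<le> block k q"
  by (auto simp: block_def intro!: div_le_mono)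

lemma rank_le_block_end: "q \<le> r (Suc k) + block k q * width k"
  using block_eq_Suc_iff[of k q] by (cases "block k q") (auto simp: block_eq_0_iff)

lemma block_le_n:
  assumes "q \<le> m (Suc k)"
  shows "block k q \<le> n (Suc k)"
proof (cases "block k q")
  case (Suc i)
  then have "r (Suc k) + i * width k < r (Suc k) + n (Suc k) * width k"
    using assms block_eq_Suc_iff[of k q i] m_Suc[of k] by linarith
  then show ?thesis
    using Suc by simp
qed simp

lemma block_end: "1 \<le> i \<Longrightarrow> block k (r (Suc k) + i * width k) = i"
  using width_pos[of k] by (cases i) (simp_all add: block_eq_Suc_iff)

lemma proj_end:
  assumes "1 \<le> i"
  shows "proj k (r (Suc k) + i * width k) = m k"
  using assms m_eq_root_width[of k] by (cases i) (simp_all only: proj_def block_end, simp_all)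

lemma proj_le_m: "proj k q \<le> m k"
  using rank_le_block_end[of q k] m_eq_root_width[of k] by (cases "block k q") (auto simp: proj_def)

lemma block_eq_0_iff_proj: "block k q = 0 \<longleftrightarrow> proj k q \<le> r (Suc k)"
proof (cases "block k q")
  case (Suc i)
  then have "r (Suc k) + i * width k < q"
    by (simp add: block_eq_Suc_iff)
  then show ?thesis
    using Suc by (simp add: proj_def)
qed (use block_eq_0_iff[of k q] in \<open>simp add: proj_def\<close>)

lemma block_Suc:
  assumes "proj k q < m k" "block k q \<noteq> 0"
  shows "block k (Suc q) = block k q"
proof -
  obtain i where i: "block k q = Suc i"
    using assms(2) not0_implies_Suc by blast
  then have "q < r (Suc k) + Suc i * width k"
    using assms(1) m_eq_root_width[of k] by (simp add: proj_def)
  then have "block k (Suc q) = Suc i"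
    using i by (simp add: block_eq_Suc_iff)
  then show ?thesis
    using i by simp
qed

lemma proj_less_imp:
  assumes "proj k q < m k" "q \<le> m (Suc k)"
  shows "q < m (Suc k)"
proof -
  have "proj k (m (Suc k)) = m k"
    using proj_end[of "n (Suc k)" k] n_ge_2[of k] m_Suc[of k] by simp
  then show ?thesis
    using assms by (cases "q = m (Suc k)") auto
qed

lemma card_block: "card {p \<in> {1..q}. block k p \<in> {0, block k q}} = proj k q"
proof (cases "block k q")
  case 0
  then have "{p \<in> {1..q}. block k p \<in> {0, block k q}} = {1..q}"
    using block_mono[of _ q k] by fastforce
  then show ?thesis
    using 0 by (simp add: proj_def)
next
  case (Suc i)
  define a where "a = r (Suc k) + i * width k"
  have q: "a < q" "q \<le> a + width k"
    using Suc by (simp_all add: block_eq_Suc_iff a_def)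
  have "p \<in> {1..q} \<and> block k p \<in> {0, Suc i} \<longleftrightarrow> p \<in> {1..r (Suc k)} \<union> {Suc a..q}" for p
    using q by (auto simp: block_eq_0_iff block_eq_Suc_iff a_def)
  then have "{p \<in> {1..q}. block k p \<in> {0, block k q}} = {1..r (Suc k)} \<union> {Suc a..q}"
    unfolding Suc by blast
  also have "card \<dots> = r (Suc k) + (q - a)"
    by (subst card_Un_disjoint) (auto simp: a_def)
  also have "\<dots> = proj k q"
    using q by (simp add: proj_def Suc a_def)
  finally show ?thesis .
qed

section \<open>Coherent hulls\<close>

text \<open>Here \<open>h b k\<close> plays the role of \<open>{x \<le> b. \<rho>(x, b) \<le> k}\<close>, the part up to \<open>b\<close> of any level-\<open>k\<close> set
  through \<open>b\<close>, so \<open>xi h k x = \<Xi>\<^sub>x(k + 1) + 1\<close>.\<close>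

type_synonym 'b hulls = "'b \<Rightarrow> nat \<Rightarrow> 'b set"

definition xi :: "'a::wellorder hulls \<Rightarrow> nat \<Rightarrow> 'a \<Rightarrow> nat" where
  "xi h k x = block k (card (h x (Suc k)))"

definition piece :: "'a::wellorder hulls \<Rightarrow> nat \<Rightarrow> 'a set \<Rightarrow> nat \<Rightarrow> 'a set" where
  "piece h k A i = {x \<in> A. xi h k x \<in> {0, i}}"

definition hull_closed :: "'a::wellorder hulls \<Rightarrow> nat \<Rightarrow> 'a set \<Rightarrow> bool" where
  "hull_closed h k A \<longleftrightarrow> finite A \<and> (\<forall>g\<in>A. h g k = A \<inter> {..g})"

definition full :: "'a::wellorder hulls \<Rightarrow> 'a \<Rightarrow> nat \<Rightarrow> bool" where
  "full h b k \<longleftrightarrow> card (h b k) = m k"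

definition coherent :: "'a::wellorder hulls \<Rightarrow> 'a \<Rightarrow> bool" where
  "coherent h b \<longleftrightarrow>
     (\<forall>k. b \<in> h b k \<and> h b k \<subseteq> {..b} \<and> card (h b k) \<le> m k \<and> hull_closed h k (h b k) \<and>
          h b k = piece h k (h b (Suc k)) (xi h k b)) \<and>
     (\<forall>g\<le>b. \<exists>k. g \<in> h b k)"

lemma
  assumes "hull_closed h k A" "x \<in> A"
  shows hull_closed_finite: "finite A"
    and hull_closed_restrict: "h x k = A \<inter> {..x}"
  using assms by (auto simp: hull_closed_def)

lemma rank_less:
  assumes A: "hull_closed h k A" "x \<in> A" "y \<in> A" and "x < y"
  shows "card (h x k) < card (h y k)"
proof (rule psubset_card_mono)
  show "finite (h y k)"
    using hull_closed_finite[OF A(1,2)] hull_closed_restrict[OF A(1,3)] by simp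
  have "y \<in> h y k" "y \<notin> h x k" "h x k \<subseteq> h y k"
    using A(3) \<open>x < y\<close> hull_closed_restrict[OF A(1,2)] hull_closed_restrict[OF A(1,3)] by auto
  then show "h x k \<subset> h y k"
    by blast
qed

lemma rank_le_iff:
  assumes "hull_closed h k A" "x \<in> A" "y \<in> A"
  shows "card (h x k) \<le> card (h y k) \<longleftrightarrow> x \<le> y"
proof
  show "x \<le> y" if "card (h x k) \<le> card (h y k)"
    using that rank_less[OF assms(1,3,2)] by (meson not_le)
  show "card (h x k) \<le> card (h y k)" if "x \<le> y"
    using that rank_less[OF assms] by (auto simp: le_less)
qed

lemma bij_betw_rank:
  assumes A: "hull_closed h k A"
  shows "bij_betw (\<lambda>x. card (h x k)) A {1..card A}"
proof -
  have inj: "inj_on (\<lambda>x. card (h x k)) A"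
    by (intro strict_mono_on_imp_inj_on strict_mono_onI rank_less[OF A])
  have "card (h x k) \<in> {1..card A}" if x: "x \<in> A" for x
    using hull_closed_finite[OF A x] hull_closed_restrict[OF A x] x
    by (auto simp: Suc_le_eq card_gt_0_iff intro: card_mono)
  then have "(\<lambda>x. card (h x k)) ` A = {1..card A}"
    by (intro card_subset_eq) (auto simp: card_image[OF inj])
  with inj show ?thesis
    by (simp add: bij_betw_def)
qed

lemma card_piece:
  assumes A: "hull_closed h (Suc k) A"
  shows "card (piece h k A i) = card {p \<in> {1..card A}. block k p \<in> {0, i}}"
proof (rule bij_betw_same_card)
  show "bij_betw (\<lambda>x. card (h x (Suc k))) (piece h k A i) {p \<in> {1..card A}. block k p \<in> {0, i}}"
    using bij_betw_rank[OF A] by (auto simp: bij_betw_def piece_def xi_def inj_on_def)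
qed

lemma xi_mono:
  assumes "hull_closed h (Suc k) A" "x \<in> A" "y \<in> A" "x \<le> y"
  shows "xi h k x \<le> xi h k y"
  using rank_le_iff[OF assms(1-3)] assms(4) by (simp add: xi_def block_mono)

lemma xi_less_imp_less:
  assumes "hull_closed h (Suc k) A" "x \<in> A" "y \<in> A" "xi h k x < xi h k y"
  shows "x < y"
  using xi_mono[OF assms(1,3,2)] assms(4) by (meson leD not_le)

lemma
  assumes "coherent h b"
  shows coherent_self: "b \<in> h b k"
    and coherent_hull_closed: "hull_closed h k (h b k)"
    and coherent_le: "x \<in> h b k \<Longrightarrow> x \<le> b"
    and coherent_card: "card (h b k) \<le> m k"
    and coherent_piece: "h b k = piece h k (h b (Suc k)) (xi h k b)"
    and coherent_cover: "g \<le> b \<Longrightarrow> \<exists>k. g \<in> h b k"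
  using assms unfolding coherent_def by blast+

lemma coherent_finite: "coherent h b \<Longrightarrow> finite (h b k)"
  using coherent_hull_closed hull_closed_def by blast

lemma coherent_restrict: "coherent h b \<Longrightarrow> g \<in> h b k \<Longrightarrow> h g k = h b k \<inter> {..g}"
  by (rule hull_closed_restrict[OF coherent_hull_closed])

lemma coherent_sub: "coherent h b \<Longrightarrow> g \<in> h b k \<Longrightarrow> h g k \<subseteq> h b k"
  using coherent_restrict by blast

lemma coherent_xi: "coherent h b \<Longrightarrow> x \<in> h b k \<Longrightarrow> xi h k x \<in> {0, xi h k b}"
  by (drule coherent_piece[of h b k]) (simp add: piece_def)

lemma coherent_mono:
  assumes "coherent h b" "k \<le> l"
  shows "h b k \<subseteq> h b l"
proof (rule lift_Suc_mono_le[of "h b", OF _ assms(2)])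
  show "h b j \<subseteq> h b (Suc j)" for j
    by (subst coherent_piece[OF assms(1), of j]) (simp add: piece_def)
qed

lemma coherent_xi_le:
  assumes "coherent h b" "x \<in> h b (Suc k)"
  shows "xi h k x \<le> xi h k b"
  using xi_mono coherent_hull_closed coherent_self coherent_le assms by metis

lemma coherent_subset_MOST:
  assumes coh_b: "coherent h b" and A: "finite A" "A \<subseteq> {..b}"
  shows "\<forall>\<^sub>\<infinity>k. A \<subseteq> h b k"
proof -
  have "\<forall>\<^sub>\<infinity>k. a \<in> h b k" if "a \<in> A" for a
  proof -
    obtain l where "a \<in> h b l"
      using coherent_cover[OF coh_b, of a] \<open>a \<in> A\<close> A(2) by blast
    then show ?thesis
      unfolding MOST_nat_le using coherent_mono[OF coh_b] by blast
  qed
  then have "\<forall>\<^sub>\<infinity>k. \<forall>a\<in>A. a \<in> h b k"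
    using A(1) by (simp add: eventually_ball_finite)
  then show ?thesis
    by (simp add: subset_eq)
qed

lemma card_hull_proj:
  assumes coh_b: "coherent h b"
  shows "card (h b k) = proj k (card (h b (Suc k)))"
proof -
  have "card (h b k) = card (piece h k (h b (Suc k)) (xi h k b))"
    using arg_cong[OF coherent_piece[OF coh_b], of card] .
  also have "\<dots> = proj k (card (h b (Suc k)))"
    unfolding card_piece[OF coherent_hull_closed[OF coh_b]] xi_def by (rule card_block)
  finally show ?thesis .
qed

lemma xi_eq_0_iff: "coherent h b \<Longrightarrow> xi h k b = 0 \<longleftrightarrow> card (h b k) \<le> r (Suc k)"
  using card_hull_proj[of h b k] by (simp add: xi_def block_eq_0_iff_proj)

lemma xi_le_n: "coherent h b \<Longrightarrow> xi h k b \<le> n (Suc k)"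
  by (simp add: xi_def block_le_n coherent_card)

lemma hull_Suc_eq:
  assumes coh_b: "coherent h b" and "xi h k b \<le> 1"
  shows "h b (Suc k) = h b k"
proof -
  have "xi h k x \<in> {0, xi h k b}" if "x \<in> h b (Suc k)" for x
    using coherent_xi_le[OF coh_b that] \<open>xi h k b \<le> 1\<close> by (auto simp: le_Suc_eq)
  then show ?thesis
    using coherent_piece[OF coh_b, of k] by (auto simp: piece_def)
qed

lemma not_full_less: "coherent h b \<Longrightarrow> \<not> full h b k \<Longrightarrow> card (h b k) < m k"
  using coherent_card[of h b k] by (simp add: full_def)

lemma not_full_mono:
  assumes coh_b: "coherent h b" and "\<not> full h b k" "k \<le> l"
  shows "\<not> full h b l"
  using assms(3,2)
proof (induction rule: dec_induct)
  case (step j)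
  then have "proj j (card (h b (Suc j))) < m j"
    using not_full_less[OF coh_b] card_hull_proj[OF coh_b, of j] by metis
  from proj_less_imp[OF this coherent_card[OF coh_b]] show ?case
    by (simp add: full_def)
qed

lemma full_piece:
  assumes coh: "\<And>x. x \<le> b \<Longrightarrow> coherent h x" and full: "full h b (Suc k)"
    and i: "1 \<le> i" "i \<le> n (Suc k)"
  shows "\<exists>f\<in>h b (Suc k). xi h k f = i \<and> full h f k \<and> h f k = piece h k (h b (Suc k)) i"
proof -
  let ?A = "h b (Suc k)" and ?q = "r (Suc k) + i * width k"
  have A: "hull_closed h (Suc k) ?A"
    using coh coherent_hull_closed by blast
  have "?q \<le> m (Suc k)" "1 \<le> ?q"
    using i m_Suc[of k] width_pos[of k] by (auto intro: add_increasing)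
  then have "?q \<in> {1..card ?A}"
    using full by (simp add: full_def)
  then obtain f where f: "f \<in> ?A" "card (h f (Suc k)) = ?q"
    using bij_betw_rank[OF A] by (metis (no_types, lifting) bij_betw_imp_surj_on imageE)
  have coh_f: "coherent h f"
    using coh f(1) coherent_le by blast
  have xi_f: "xi h k f = i"
    unfolding xi_def f(2) using block_end[OF i(1)] .
  have "x \<le> f" if x: "x \<in> ?A" "xi h k x \<in> {0, i}" for x
  proof -
    have "card (h x (Suc k)) \<le> ?q"
      using x(2) rank_le_block_end[of "card (h x (Suc k))" k] by (auto simp: xi_def)
    then show ?thesis
      using rank_le_iff[OF A x(1) f(1)] f(2) by simp
  qed
  then have "h f k = piece h k ?A i"
    using coherent_piece[OF coh_f, of k] hull_closed_restrict[OF A f(1)] xi_f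
    by (auto simp: piece_def)
  moreover have "full h f k"
    using card_hull_proj[OF coh_f, of k] f(2) proj_end[OF i(1)] by (simp add: full_def)
  ultimately show ?thesis
    using f(1) xi_f by (intro bexI[of _ f]) auto
qed

lemma full_hull_within:
  assumes coh: "\<And>x. x \<le> b \<Longrightarrow> coherent h x" and full: "full h b k" and y: "y \<in> h b k" and "l \<le> k"
  shows "\<exists>f\<in>h b k. y \<in> h f l \<and> full h f l"
  using \<open>l \<le> k\<close>
proof (induction rule: inc_induct)
  case base
  show ?case
    using coh coherent_self full y by blast
next
  case (step l)
  have coh_b: "coherent h b"
    using coh by simp
  obtain f where f: "f \<in> h b k" "y \<in> h f (Suc l)" "full h f (Suc l)"
    using step.IH by blast
  have coh_le_f: "\<And>x. x \<le> f \<Longrightarrow> coherent h x"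
    using coh coherent_le[OF coh_b f(1)] by (meson order_trans)
  define i where "i = max 1 (xi h l y)"
  have "xi h l y \<le> n (Suc l)"
    using xi_le_n coh_le_f coherent_le f(2) by blast
  then have "1 \<le> i" "i \<le> n (Suc l)"
    using n_ge_2[of l] by (simp_all add: i_def)
  from full_piece[OF coh_le_f f(3) this]
  obtain g where g: "g \<in> h f (Suc l)" "full h g l" "h g l = piece h l (h f (Suc l)) i"
    by auto
  have "h f (Suc l) \<subseteq> h b k"
    using coherent_mono[OF coh_le_f[OF order_refl], of "Suc l" k] coherent_sub[OF coh_b f(1)] step.hyps
    by auto
  moreover have "y \<in> h g l"
    using f(2) by (auto simp: g(3) piece_def i_def)
  ultimately show ?case
    using g(1,2) by (intro bexI[of _ g]) auto
qed

section \<open>Adding a point on top of coherent hulls\<close>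

definition stem :: "'a::wellorder hulls \<Rightarrow> nat \<Rightarrow> 'a set \<Rightarrow> bool" where
  "stem h k A \<longleftrightarrow> hull_closed h k A \<and> card A < m k"

text \<open>If the level-\<open>k + 1\<close> hull of a new point consists of the point and \<open>A\<close>, then its level-\<open>k\<close> hull
  consists of the point and \<open>trace h k A\<close>.\<close>

definition trace :: "'a::wellorder hulls \<Rightarrow> nat \<Rightarrow> 'a set \<Rightarrow> 'a set" where
  "trace h k A = piece h k A (block k (Suc (card A)))"

lemma hull_closed_piece:
  assumes A: "hull_closed h (Suc k) A" and coh: "\<And>g. g \<in> A \<Longrightarrow> coherent h g"
  shows "hull_closed h k (piece h k A i)"
proof -
  have "h g k = piece h k A i \<inter> {..g}" if g: "g \<in> piece h k A i" for g
  proof -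
    have g_A: "g \<in> A" "xi h k g \<in> {0, i}"
      using g by (auto simp: piece_def)
    have "xi h k x \<in> {0, xi h k g} \<longleftrightarrow> xi h k x \<in> {0, i}" if "x \<in> A" "x \<le> g" for x
      using xi_mono[OF A that(1) g_A(1) that(2)] g_A(2) by auto
    then show ?thesis
      using coherent_piece[OF coh[OF g_A(1)], of k] hull_closed_restrict[OF A g_A(1)]
      by (auto simp: piece_def)
  qed
  then show ?thesis
    using A by (auto simp: hull_closed_def piece_def)
qed

lemma card_trace:
  assumes A: "hull_closed h (Suc k) A"
  shows "Suc (card (trace h k A)) = proj k (Suc (card A))"
proof -
  let ?q = "Suc (card A)"
  let ?P = "\<lambda>p. block k p \<in> {0, block k ?q}"
  have "{p \<in> {1..?q}. ?P p} = insert ?q {p \<in> {1..card A}. ?P p}"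
    by (auto simp: le_Suc_eq)
  then have "card {p \<in> {1..?q}. ?P p} = Suc (card {p \<in> {1..card A}. ?P p})"
    by simp
  then show ?thesis
    unfolding trace_def card_piece[OF A] card_block by simp
qed

lemma stem_trace:
  assumes A: "stem h (Suc k) A" and coh: "\<And>g. g \<in> A \<Longrightarrow> coherent h g"
  shows "stem h k (trace h k A)"
proof -
  have A': "hull_closed h (Suc k) A"
    using A by (simp add: stem_def)
  have "card (trace h k A) < m k"
    using card_trace[OF A'] proj_le_m[of k "Suc (card A)"] by simp
  then show ?thesis
    using hull_closed_piece[OF A' coh] by (simp add: stem_def trace_def)
qed

lemma stems_extend_down:
  assumes coh: "\<And>g. g < b \<Longrightarrow> coherent h g"
    and stem: "\<And>k. k0 \<le> k \<Longrightarrow> stem h k (A k)"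
    and less: "\<And>k. k0 \<le> k \<Longrightarrow> A k \<subseteq> {..<b}"
    and trace: "\<And>k. k0 \<le> k \<Longrightarrow> A k = trace h k (A (Suc k))"
  shows "\<exists>A'. (\<forall>k\<ge>k0. A' k = A k) \<and> (\<forall>k. stem h k (A' k)) \<and>
    (\<forall>k. A' k \<subseteq> {..<b}) \<and> (\<forall>k. A' k = trace h k (A' (Suc k)))"
  using stem less trace
proof (induction k0 arbitrary: A)
  case 0
  show ?case
    by (intro exI[of _ A] conjI allI impI refl) (rule 0 le0)+
next
  case (Suc k0)
  define A' where "A' = A(k0 := trace h k0 (A (Suc k0)))"
  have A'_k0: "A' k0 = trace h k0 (A' (Suc k0))"
    by (simp add: A'_def)
  have "stem h (Suc k0) (A (Suc k0))" "A (Suc k0) \<subseteq> {..<b}"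
    using Suc.prems(1,2) by auto
  then have k0: "stem h k0 (A' k0)" "A' k0 \<subseteq> {..<b}"
    using stem_trace[of h k0 "A (Suc k0)"] coh by (auto simp: A'_def trace_def piece_def)
  have "stem h k (A' k) \<and> A' k \<subseteq> {..<b} \<and> A' k = trace h k (A' (Suc k))" if "k0 \<le> k" for k
  proof (cases "k = k0")
    case True
    then show ?thesis
      using k0 A'_k0 by simp
  next
    case False
    then show ?thesis
      using that Suc.prems[of k] by (simp add: A'_def)
  qed
  then have "\<exists>A''. (\<forall>k\<ge>k0. A'' k = A' k) \<and> (\<forall>k. stem h k (A'' k)) \<and>
      (\<forall>k. A'' k \<subseteq> {..<b}) \<and> (\<forall>k. A'' k = trace h k (A'' (Suc k)))"
    by (intro Suc.IH) blast+
  then obtain A'' where eq: "\<forall>k\<ge>k0. A'' k = A' k"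
    and A'': "\<forall>k. stem h k (A'' k)" "\<forall>k. A'' k \<subseteq> {..<b}" "\<forall>k. A'' k = trace h k (A'' (Suc k))"
    by (elim exE conjE)
  have "\<forall>k\<ge>Suc k0. A'' k = A k"
    using eq by (simp add: A'_def)
  with A'' show ?case
    by blast
qed

lemma hull_closed_insert:
  assumes A: "hull_closed h k A" "A \<subseteq> {..<b}" and B: "B k = insert b A"
  shows "hull_closed (h(b := B)) k (insert b A)"
proof -
  have "(h(b := B)) g k = insert b A \<inter> {..g}" if g: "g \<in> insert b A" for g
  proof (cases "g = b")
    case True
    then show ?thesis
      using A(2) B by auto
  next
    case False
    then have "h g k = A \<inter> {..g}" "g < b"
      using g A by (auto simp: hull_closed_def)
    then show ?thesis
      using False by auto
  qed
  then show ?thesis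
    using A(1) by (simp add: hull_closed_def)
qed

lemma coherent_insert_stems:
  assumes stem: "\<And>k. stem h k (A k)" and less: "\<And>k. A k \<subseteq> {..<b}"
    and trace: "\<And>k. A k = trace h k (A (Suc k))" and cover: "\<And>g. g < b \<Longrightarrow> \<exists>k. g \<in> A k"
  shows "coherent (h(b := \<lambda>k. insert b (A k))) b"
proof -
  define h' where "h' = h(b := \<lambda>k. insert b (A k))"
  have h'b: "h' b k = insert b (A k)" and h': "x \<noteq> b \<Longrightarrow> h' x = h x" for x k
    by (simp_all add: h'_def)
  have A: "finite (A k)" "b \<notin> A k" for k
    using stem[of k] less[of k] by (auto simp: stem_def hull_closed_def)
  have xi_b: "xi h' k b = block k (Suc (card (A (Suc k))))" for k
    using A by (simp add: xi_def h'b)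
  have xi: "xi h' k x = xi h k x" if "x \<in> A l" for x k l
  proof -
    have "x \<noteq> b"
      using A(2)[of l] that by blast
    then show ?thesis
      by (simp add: xi_def h')
  qed
  have "coherent h' b"
    unfolding coherent_def
  proof (intro conjI allI impI)
    fix k
    show "b \<in> h' b k" "h' b k \<subseteq> {..b}"
      using less[of k] by (auto simp: h'b)
    show "card (h' b k) \<le> m k"
      using stem[of k] A by (simp add: h'b stem_def Suc_le_eq)
    show "hull_closed h' k (h' b k)"
      using hull_closed_insert[OF _ less] stem by (simp add: stem_def h'_def)
    have "A k = {x \<in> A (Suc k). xi h' k x \<in> {0, xi h' k b}}"
      by (subst trace[of k]) (auto simp: trace_def piece_def xi xi_b)
    then show "h' b k = piece h' k (h' b (Suc k)) (xi h' k b)"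
      using A by (auto simp: h'b piece_def)
  next
    fix g assume "g \<le> b"
    then show "\<exists>k. g \<in> h' b k"
      using cover[of g] by (auto simp: h'b le_less)
  qed
  then show ?thesis
    unfolding h'_def .
qed

lemma coherent_extend:
  assumes coh: "\<And>g. g < b \<Longrightarrow> coherent h g"
    and stem: "\<And>k. k0 \<le> k \<Longrightarrow> stem h k (A k)"
    and less: "\<And>k. k0 \<le> k \<Longrightarrow> A k \<subseteq> {..<b}"
    and trace: "\<And>k. k0 \<le> k \<Longrightarrow> A k = trace h k (A (Suc k))"
    and cover: "\<And>g. g < b \<Longrightarrow> \<exists>k\<ge>k0. g \<in> A k"
  shows "\<exists>B. (\<forall>k\<ge>k0. B k = insert b (A k)) \<and> coherent (h(b := B)) b"
proof -
  have "\<exists>A'. (\<forall>k\<ge>k0. A' k = A k) \<and> (\<forall>k. stem h k (A' k)) \<and>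
    (\<forall>k. A' k \<subseteq> {..<b}) \<and> (\<forall>k. A' k = trace h k (A' (Suc k)))"
    by (rule stems_extend_down) (fact coh stem less trace)+
  then obtain A' where eq: "\<forall>k\<ge>k0. A' k = A k"
    and A': "\<forall>k. stem h k (A' k)" "\<forall>k. A' k \<subseteq> {..<b}" "\<forall>k. A' k = trace h k (A' (Suc k))"
    by (elim exE conjE)
  have "\<exists>k. g \<in> A' k" if "g < b" for g
    using cover[OF that] eq by blast
  then have "coherent (h(b := \<lambda>k. insert b (A' k))) b"
    by (rule coherent_insert_stems[OF A'[rule_format]])
  then show ?thesis
    using eq by (intro exI[of _ "\<lambda>k. insert b (A' k)"]) simp
qed

lemma stem_hull: "coherent h z \<Longrightarrow> \<not> full h z k \<Longrightarrow> stem h k (h z k)"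
  by (simp add: stem_def coherent_hull_closed not_full_less)

text \<open>If the root of a level-\<open>k + 1\<close> set through \<open>b\<close> ends at \<open>a\<close> and \<open>b\<close> lies in the piece \<open>F\<^sub>0\<close>, then
  a new point following \<open>a\<close> is free to choose its piece in such a set.\<close>

definition root_ends_at :: "'a::wellorder hulls \<Rightarrow> 'a \<Rightarrow> 'a \<Rightarrow> nat \<Rightarrow> bool" where
  "root_ends_at h a b k \<longleftrightarrow> a < b \<and> a \<in> h b k \<and> r (Suc k) = card (h a k)"

definition branches_off :: "'a::wellorder hulls \<Rightarrow> 'a \<Rightarrow> 'a \<Rightarrow> nat \<Rightarrow> bool" where
  "branches_off h a b k \<longleftrightarrow> root_ends_at h a b k \<and> xi h k b = 1"

definition jumps :: "'a::wellorder hulls \<Rightarrow> 'a \<Rightarrow> 'a \<Rightarrow> nat \<Rightarrow> bool" where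
  "jumps h z z' k \<longleftrightarrow> branches_off h z z' k \<and> full h z' k"

definition follows :: "'a::wellorder hulls \<Rightarrow> 'a \<Rightarrow> 'a \<Rightarrow> nat \<Rightarrow> bool" where
  "follows h d z k \<longleftrightarrow> z < d \<and> \<not> full h z k \<and>
     h d k = insert d (h z k) \<and> h d (Suc k) = insert d (h z (Suc k))"

lemma root_ends_at_xi_pos:
  assumes coh_b: "coherent h b" and "root_ends_at h a b k"
  shows "xi h k b > 0"
proof -
  have "card (h a k) < card (h b k)"
    using assms rank_less[OF coherent_hull_closed[OF coh_b] _ coherent_self[OF coh_b]]
    by (simp add: root_ends_at_def)
  then show ?thesis
    using xi_eq_0_iff[OF coh_b, of k] assms(2) by (simp add: root_ends_at_def)
qed

lemma branches_off_hull_Suc: "coherent h b \<Longrightarrow> branches_off h a b k \<Longrightarrow> h b (Suc k) = h b k"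
  by (simp add: hull_Suc_eq branches_off_def)

lemma branches_off_upward:
  assumes coh: "coherent h c" "b \<in> h c k" and a: "branches_off h a b k"
  shows "branches_off h a c k"
proof -
  have "a < c" "a \<in> h c k"
    using coherent_le[OF coh] coherent_sub[OF coh] a by (auto simp: branches_off_def root_ends_at_def)
  moreover have "xi h k c = 1"
    using coherent_xi[OF coh] a by (simp add: branches_off_def)
  ultimately show ?thesis
    using a by (simp add: branches_off_def root_ends_at_def)
qed

lemma jumps_not_full:
  assumes "coherent h z'" "jumps h z z' k" "k < l"
  shows "\<not> full h z' l"
proof (rule not_full_mono[OF assms(1)])
  show "\<not> full h z' (Suc k)"
    using branches_off_hull_Suc[OF assms(1), of z k] assms(2) m_less_Suc[of k]
    by (simp add: jumps_def full_def)
qed (use assms(3) in simp)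

lemma block_Suc_card_hull:
  assumes coh_z: "coherent h z" and "\<not> full h z k" "xi h k z \<noteq> 0"
  shows "block k (Suc (card (h z (Suc k)))) = xi h k z"
  using block_Suc[of k "card (h z (Suc k))"] not_full_less[OF coh_z, of k] assms
    card_hull_proj[OF coh_z, of k]
  by (simp add: xi_def)

lemma trace_hull:
  assumes coh_z: "coherent h z" and "\<not> full h z k"
  shows "trace h k (h z (Suc k)) = h z k"
proof (cases "xi h k z = 0")
  case True
  then have "xi h k x = 0" if "x \<in> h z (Suc k)" for x
    using coherent_xi_le[OF coh_z that] by simp
  then show ?thesis
    using hull_Suc_eq[OF coh_z, of k] True by (auto simp: trace_def piece_def)
next
  case False
  then show ?thesis
    using block_Suc_card_hull[OF assms] coherent_piece[OF coh_z, of k] by (simp add: trace_def)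
qed

lemma trace_hull_jumps:
  assumes coh_z': "coherent h z'" and j: "jumps h z z' k"
  shows "trace h k (h z' (Suc k)) = h z k"
proof -
  have eq: "h z' (Suc k) = h z' k"
    using branches_off_hull_Suc[OF coh_z', of z k] j by (simp add: jumps_def)
  have A: "hull_closed h (Suc k) (h z' k)" "hull_closed h k (h z' k)"
    using coherent_hull_closed[OF coh_z'] eq by metis+
  have z: "z \<in> h z' k" "card (h z k) = r (Suc k)"
    using j by (auto simp: jumps_def branches_off_def root_ends_at_def)
  have block_new: "block k (Suc (card (h z' k))) = 2"
    using j block_eq_Suc_iff[of k "Suc (m k)" 1] m_eq_root_width[of k] width_pos[of k]
    by (simp add: jumps_def full_def)
  have "xi h k x \<in> {0, 2} \<longleftrightarrow> x \<le> z" if x: "x \<in> h z' k" for x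
  proof -
    have "xi h k x \<le> 1"
      using coherent_xi_le[OF coh_z', of x k] x eq j by (simp add: jumps_def branches_off_def)
    moreover have "h x (Suc k) = h x k"
      using hull_closed_restrict[OF A(1) x] hull_closed_restrict[OF A(2) x] by simp
    then have "xi h k x = 0 \<longleftrightarrow> x \<le> z"
      using rank_le_iff[OF A(2) x z(1)] z(2) by (simp add: xi_def block_eq_0_iff)
    ultimately show ?thesis
      by auto
  qed
  then have "trace h k (h z' (Suc k)) = h z' k \<inter> {..z}"
    by (auto simp: trace_def piece_def eq block_new)
  then show ?thesis
    using coherent_restrict[OF coh_z' z(1)] by simp
qed

section \<open>Generic hulls\<close>

text \<open>The tuple \<open>t\<close> occupies the first pieces \<open>F\<^sub>0, F\<^sub>1, \<dots>\<close> of a level-\<open>k + 1\<close> set through \<open>e\<close>. For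
  coherent \<open>h\<close> the condition \<open>v \<le> e\<close> is redundant; it makes the notion depend on the hulls up to \<open>e\<close> only.\<close>

definition occupies :: "'a::wellorder hulls \<Rightarrow> nat \<Rightarrow> 'a set list \<Rightarrow> 'a \<Rightarrow> bool" where
  "occupies h k t e \<longleftrightarrow> (\<forall>i<length t. \<forall>v\<in>t ! i. v \<le> e \<and> v \<in> h e (Suc k) \<and> xi h k v = Suc i)"

text \<open>A later point that follows some \<open>z \<in> Z\<close> at level \<open>K\<close> can leave \<open>z\<close> and move past \<open>y\<close> before
  level \<open>k\<close>.\<close>

definition reachable :: "'a::wellorder hulls \<Rightarrow> 'a set \<Rightarrow> nat \<Rightarrow> nat \<Rightarrow> 'a \<Rightarrow> bool" where
  "reachable h Z K k y \<longleftrightarrow> (\<forall>z\<in>Z. \<exists>l. K < l \<and> l < k \<and> branches_off h z y l \<and> \<not> full h y l)"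

definition catches :: "'a::wellorder hulls \<Rightarrow> 'a set list \<Rightarrow> 'a set \<Rightarrow> nat \<Rightarrow> 'a \<Rightarrow> nat \<Rightarrow> bool" where
  "catches h t Z K e k \<longleftrightarrow> K < k \<and> xi h k e = Suc (length t) \<and> occupies h k t e \<and>
     (\<exists>y. root_ends_at h y e k \<and> reachable h Z K k y)"

definition caught_below :: "'a::wellorder hulls \<Rightarrow> 'a set list set \<Rightarrow> 'a \<Rightarrow> bool" where
  "caught_below h T d \<longleftrightarrow>
     (\<forall>Z K. finite Z \<and> Z \<subseteq> {..<d} \<longrightarrow> (\<exists>e<d. \<exists>k. \<exists>t\<in>T. catches h t Z K e k))"

definition caught_by :: "'a::wellorder hulls \<Rightarrow> 'a set list set \<Rightarrow> 'a \<Rightarrow> bool" where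
  "caught_by h T d \<longleftrightarrow>
     (\<forall>Z K. finite Z \<and> Z \<subseteq> {..<d} \<longrightarrow> (\<exists>k. \<exists>t\<in>T. catches h t Z K d k))"

text \<open>The limit \<open>d\<close> is offered the tuples in \<open>T s d\<close>; the principle \<open>\<clubsuit>\<close> enters only through the choice of \<open>T\<close>.\<close>

definition generic_hull :: "(nat \<Rightarrow> 'a::wellorder \<Rightarrow> 'a set list set) \<Rightarrow> 'a hulls \<Rightarrow> 'a \<Rightarrow> bool" where
  "generic_hull T h d \<longleftrightarrow> coherent h d \<and>
     (\<forall>j. \<exists>\<^sub>\<infinity>k. r (Suc k) = card (h d k) + j) \<and>
     (\<forall>a<d. \<exists>\<^sub>\<infinity>k. branches_off h a d k) \<and>
     (\<forall>b k. is_succ b d \<and> \<not> full h b k \<longrightarrow> follows h d b k) \<and>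
     (\<forall>s. is_lim d \<and> caught_below h (T s d) d \<longrightarrow> caught_by h (T s d) d)"

lemma
  assumes "generic_hull T h d"
  shows generic_hull_coherent: "coherent h d"
    and generic_hull_root_size: "\<exists>\<^sub>\<infinity>k. r (Suc k) = card (h d k) + j"
    and generic_hull_branches_off: "a < d \<Longrightarrow> \<exists>\<^sub>\<infinity>k. branches_off h a d k"
    and generic_hull_follows: "is_succ b d \<Longrightarrow> \<not> full h b k \<Longrightarrow> follows h d b k"
    and generic_hull_caught: "is_lim d \<Longrightarrow> caught_below h (T s d) d \<Longrightarrow> caught_by h (T s d) d"
  using assms unfolding generic_hull_def by blast+

subsection \<open>Dependence on the hulls of smaller points only\<close>

lemma coherent_cong:
  assumes "\<And>y. y \<le> x \<Longrightarrow> f y = g y"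
  shows "coherent f x \<longleftrightarrow> coherent g x"
proof -
  have "coherent g x" if eq: "\<And>y. y \<le> x \<Longrightarrow> f y = g y" and f: "coherent f x" for f g
  proof -
    have hulls: "f x k \<subseteq> {..x}" "g x k = f x k" for k
      using coherent_le[OF f] eq[of x] by auto
    have "g y k = f y k" if "y \<in> f x k" for y k
      using hulls(1)[of k] eq[of y] that by auto
    then have "hull_closed g k (f x k)" for k
      using coherent_hull_closed[OF f, of k] by (simp add: hull_closed_def)
    moreover have "f x k = piece g k (f x (Suc k)) (xi g k x)" for k
    proof -
      have "f x k = piece f k (f x (Suc k)) (xi f k x)"
        by (rule coherent_piece[OF f])
      also have "\<dots> = piece g k (f x (Suc k)) (xi g k x)"
        using hulls(1)[of "Suc k"] eq by (auto simp: piece_def xi_def)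
      finally show ?thesis .
    qed
    ultimately show ?thesis
      unfolding coherent_def hulls(2)
      using hulls(1) coherent_self[OF f] coherent_card[OF f] coherent_cover[OF f] by blast
  qed
  from this[of f g] this[of g f] assms show ?thesis
    by metis
qed

lemma root_ends_at_cong:
  "(\<And>y. y \<le> b \<Longrightarrow> f y = g y) \<Longrightarrow> root_ends_at f a b k \<longleftrightarrow> root_ends_at g a b k"
  by (simp add: root_ends_at_def cong: conj_cong)

lemma branches_off_cong:
  "(\<And>y. y \<le> b \<Longrightarrow> f y = g y) \<Longrightarrow> branches_off f a b k \<longleftrightarrow> branches_off g a b k"
  by (simp add: branches_off_def xi_def root_ends_at_cong[of b f g])

lemma reachable_cong:
  "(\<And>x. x \<le> y \<Longrightarrow> f x = g x) \<Longrightarrow> reachable f Z K k y \<longleftrightarrow> reachable g Z K k y"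
  by (simp add: reachable_def full_def branches_off_cong[of y f g])

lemma occupies_cong:
  "(\<And>y. y \<le> e \<Longrightarrow> f y = g y) \<Longrightarrow> occupies f k t e \<longleftrightarrow> occupies g k t e"
  by (simp add: occupies_def xi_def cong: conj_cong)

lemma catches_cong:
  assumes "\<And>y. y \<le> e \<Longrightarrow> f y = g y"
  shows "catches f t Z K e k \<longleftrightarrow> catches g t Z K e k"
proof -
  have "reachable f Z K k y \<longleftrightarrow> reachable g Z K k y" if "root_ends_at g y e k" for y
    using that assms by (intro reachable_cong) (auto simp: root_ends_at_def)
  then show ?thesis
    using assms occupies_cong[of e f g] root_ends_at_cong[of e f g]
    by (auto simp: catches_def xi_def)
qed

lemma caught_below_cong:
  assumes "\<And>y. y < d \<Longrightarrow> f y = g y"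
  shows "caught_below f T d \<longleftrightarrow> caught_below g T d"
proof -
  have "catches f t Z K e k \<longleftrightarrow> catches g t Z K e k" if "e < d" for t Z K e k
    using that assms by (intro catches_cong) auto
  then show ?thesis
    by (simp add: caught_below_def cong: conj_cong)
qed

lemma generic_hull_cong:
  assumes eq: "\<And>y. y \<le> d \<Longrightarrow> f y = g y"
  shows "generic_hull T f d \<longleftrightarrow> generic_hull T g d"
proof -
  have "(is_succ b d \<and> \<not> full f b k \<longrightarrow> follows f d b k) \<longleftrightarrow>
      (is_succ b d \<and> \<not> full g b k \<longrightarrow> follows g d b k)" for b k
    using eq by (auto simp: is_succ_def full_def follows_def)
  moreover have "caught_by f S d \<longleftrightarrow> caught_by g S d" for S
    using catches_cong[OF eq] by (simp add: caught_by_def)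
  ultimately show ?thesis
    using coherent_cong[of d f g] branches_off_cong[of d f g] caught_below_cong[of d f g] eq
    by (simp add: generic_hull_def)
qed

subsection \<open>Following a point\<close>

lemma follows_card:
  assumes coh_z: "coherent h z" and follows: "follows h d z k"
  shows "card (h d k) = Suc (card (h z k))" "card (h d (Suc k)) = Suc (card (h z (Suc k)))"
proof -
  have "d \<notin> h z l" for l
    using follows coherent_le[OF coh_z, of d l] by (auto simp: follows_def)
  then show "card (h d k) = Suc (card (h z k))" "card (h d (Suc k)) = Suc (card (h z (Suc k)))"
    using follows coherent_finite[OF coh_z] by (simp_all add: follows_def)
qed

lemma follows_xi:
  assumes coh_z: "coherent h z" and follows: "follows h d z k" and "xi h k z \<noteq> 0"
  shows "xi h k d = xi h k z"
  using block_Suc_card_hull[OF coh_z _ assms(3)] follows_card(2)[OF coh_z follows] follows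
  by (simp add: follows_def xi_def)

lemma follows_root_ends_at: "follows h d z k \<Longrightarrow> root_ends_at h a z k \<Longrightarrow> root_ends_at h a d k"
  by (auto simp: follows_def root_ends_at_def)

lemma follows_branches_off:
  "coherent h z \<Longrightarrow> follows h d z k \<Longrightarrow> branches_off h a z k \<Longrightarrow> branches_off h a d k"
  using follows_root_ends_at[of h d z k a] follows_xi[of h z d k] by (simp add: branches_off_def)

lemma follows_catches:
  assumes coh_z: "coherent h z" and follows: "follows h d z k" and c: "catches h t Z K z k"
  shows "catches h t Z K d k"
proof -
  have "occupies h k t d"
    using c follows
    by (auto simp: catches_def occupies_def follows_def intro: order_trans[OF _ less_imp_le])
  moreover have "xi h k d = xi h k z"
    by (rule follows_xi[OF coh_z follows]) (use c in \<open>simp add: catches_def\<close>)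
  ultimately show ?thesis
    using c follows_root_ends_at[OF follows] by (auto simp: catches_def)
qed

lemma follows_self_branches_off:
  assumes coh_z: "coherent h z" and follows: "follows h d z k" and root: "r (Suc k) = card (h z k)"
  shows "branches_off h z d k"
proof -
  have "h z (Suc k) = h z k"
    using hull_Suc_eq[OF coh_z, of k] xi_eq_0_iff[OF coh_z, of k] root by simp
  then have "card (h d (Suc k)) = Suc (r (Suc k))"
    using follows_card(2)[OF coh_z follows] root by simp
  then have "xi h k d = 1"
    by (simp add: xi_def block_def)
  moreover have "root_ends_at h z d k"
    using follows root coherent_self[OF coh_z] by (simp add: root_ends_at_def follows_def)
  ultimately show ?thesis
    by (simp add: branches_off_def)
qed

lemma
  assumes coh_z: "coherent h z" and follows: "follows (h(d := B)) d z k"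
  shows follows_update_card: "card (B k) = Suc (card (h z k))"
    and follows_update_branches_off: "branches_off h a z k \<Longrightarrow> branches_off (h(d := B)) a d k"
    and follows_update_self: "r (Suc k) = card (h z k) \<Longrightarrow> branches_off (h(d := B)) z d k"
    and follows_update_catches: "catches h t Z K z k \<Longrightarrow> catches (h(d := B)) t Z K d k"
proof -
  define h' where "h' = h(d := B)"
  have eq: "h' y = h y" if "y \<le> z" for y
    using that follows by (auto simp: h'_def follows_def)
  have coh_h': "coherent h' z" and follows_h': "follows h' d z k"
    using coherent_cong[of z h' h] eq coh_z follows by (simp_all add: h'_def)
  show "card (B k) = Suc (card (h z k))"
    using follows_card(1)[OF coh_h' follows_h'] eq by (simp add: h'_def)
  show "branches_off h' a d k" if "branches_off h a z k"
    using follows_branches_off[OF coh_h' follows_h'] branches_off_cong[of z h' h] eq that by simp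
  show "branches_off h' z d k" if "r (Suc k) = card (h z k)"
    using follows_self_branches_off[OF coh_h' follows_h'] eq that by simp
  show "catches h' t Z K d k" if "catches h t Z K z k"
    using follows_catches[OF coh_h' follows_h'] catches_cong[of z h' h] eq that by simp
qed

lemma coherent_successor:
  assumes succ: "is_succ b d" and coh: "\<And>g. g < d \<Longrightarrow> coherent h g" and "\<forall>\<^sub>\<infinity>k. \<not> full h b k"
  shows "\<exists>B. coherent (h(d := B)) d \<and> (\<forall>k. \<not> full h b k \<longrightarrow> follows (h(d := B)) d b k)"
proof -
  have b_less_d: "b < d"
    using succ by (simp add: is_succ_def)
  then have coh_b: "coherent h b"
    by (rule coh)
  define k0 where "k0 = (LEAST k. \<not> full h b k)"
  have "\<exists>k. \<not> full h b k"
    using assms(3) by (auto simp: MOST_nat_le)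
  then have "\<not> full h b k0"
    unfolding k0_def by (rule LeastI_ex)
  then have not_full: "\<not> full h b k \<longleftrightarrow> k0 \<le> k" for k
    using not_full_mono[OF coh_b] Least_le[of "\<lambda>k. \<not> full h b k" k] unfolding k0_def by blast
  have "\<exists>B. (\<forall>k\<ge>k0. B k = insert d (h b k)) \<and> coherent (h(d := B)) d"
  proof (rule coherent_extend)
    show "h b k \<subseteq> {..<d}" for k
      using coherent_le[OF coh_b] b_less_d by fastforce
    show "h b k = trace h k (h b (Suc k))" if "k0 \<le> k" for k
      using trace_hull[OF coh_b] not_full that by simp
    show "\<exists>k\<ge>k0. g \<in> h b k" if "g < d" for g
    proof -
      obtain k where "g \<in> h b k"
        using coherent_cover[OF coh_b is_succ_le[OF succ \<open>g < d\<close>]] by blast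
      then show ?thesis
        using coherent_mono[OF coh_b, of k "max k k0"] by (intro exI[of _ "max k k0"]) auto
    qed
    show "stem h k (h b k)" if "k0 \<le> k" for k
      using stem_hull[OF coh_b] not_full that by simp
  qed (rule coh)
  then obtain B where B: "\<And>k. k0 \<le> k \<Longrightarrow> B k = insert d (h b k)" "coherent (h(d := B)) d"
    by blast
  have "follows (h(d := B)) d b k" if "\<not> full h b k" for k
    using that B(1)[of k] B(1)[of "Suc k"] not_full[of k] b_less_d less_imp_neq[OF b_less_d]
    by (simp add: follows_def full_def)
  with B(2) show ?thesis
    by blast
qed

subsection \<open>Meeting countably many requirements\<close>

definition dense_below :: "'a::wellorder hulls \<Rightarrow> 'a \<Rightarrow> ('a \<Rightarrow> nat \<Rightarrow> bool) \<Rightarrow> bool" where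
  "dense_below h d Q \<longleftrightarrow> (\<forall>z<d. \<forall>N. \<exists>z'<d. \<exists>l>N. jumps h z z' l \<and> (\<exists>k>l. Q z' k))"

lemma jump_sequence:
  fixes d :: "'a::wellorder"
  assumes "z0 < d" and dense: "\<And>i. dense_below h d (Q i)"
  shows "\<exists>z l. (\<forall>i. z i < d) \<and> strict_mono l \<and> (\<forall>i. jumps h (z i) (z (Suc i)) (l i)) \<and>
    (\<forall>i. \<exists>k. l i < k \<and> k < l (Suc i) \<and> Q i (z (Suc i)) k)"
proof -
  define step where "step i = (\<lambda>(z, N) (z', k). \<exists>l>N. l < k \<and> jumps h z z' l \<and> Q i z' k)" for i
  have "\<exists>f. \<forall>i. fst (f i) < d \<and> step i (f i) (f (Suc i))"
  proof (rule dependent_nat_choice)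
    show "\<exists>zN :: 'a \<times> nat. fst zN < d"
      using \<open>z0 < d\<close> by auto
    fix zN :: "'a \<times> nat" and i assume "fst zN < d"
    then show "\<exists>zN'. fst zN' < d \<and> step i zN zN'"
      using dense[of i] by (cases zN) (fastforce simp: dense_below_def step_def)
  qed
  then obtain f where f: "\<And>i. fst (f i) < d" "\<And>i. step i (f i) (f (Suc i))"
    by blast
  define z N where "z i = fst (f i)" and "N i = snd (f i)" for i
  have "\<exists>l>N i. l < N (Suc i) \<and> jumps h (z i) (z (Suc i)) l \<and> Q i (z (Suc i)) (N (Suc i))" for i
    using f(2)[of i] by (simp add: step_def z_def N_def case_prod_unfold)
  then obtain l where l: "\<And>i. N i < l i" "\<And>i. l i < N (Suc i)" "\<And>i. jumps h (z i) (z (Suc i)) (l i)"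
    "\<And>i. Q i (z (Suc i)) (N (Suc i))"
    by metis
  have "strict_mono l"
    using l(1,2) by (auto simp: strict_mono_Suc_iff intro: less_trans)
  moreover have "z i < d" for i
    using f(1) by (simp add: z_def)
  ultimately show ?thesis
    using l by blast
qed

lemma trace_jump_sequence:
  assumes coh: "\<And>i. coherent h (z i)" and l: "strict_mono l"
    and jumps: "\<And>i. jumps h (z i) (z (Suc i)) (l i)"
    and A: "\<And>i k. l i < k \<Longrightarrow> k \<le> l (Suc i) \<Longrightarrow> A k = h (z (Suc i)) k"
    and k: "l i < k" "k \<le> l (Suc i)"
  shows "A k = trace h k (A (Suc k))"
proof (cases "k = l (Suc i)")
  case True
  moreover have "A (Suc k) = h (z (Suc (Suc i))) (Suc k)"
    using A[of "Suc i" "Suc k"] True l by (simp add: strict_mono_less Suc_le_eq)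
  ultimately show ?thesis
    using A[OF k] trace_hull_jumps[OF coh jumps, of "Suc i"] by simp
next
  case False
  then show ?thesis
    using A[OF k] A[of i "Suc k"] k trace_hull[OF coh jumps_not_full[OF coh jumps k(1)]] by simp
qed

lemma coherent_jump_limit:
  assumes coh: "\<And>g. g < d \<Longrightarrow> coherent h g" and z: "\<And>i. z i < d" and l: "strict_mono l"
    and jumps: "\<And>i. jumps h (z i) (z (Suc i)) (l i)"
    and cover: "\<And>g. g < d \<Longrightarrow> \<exists>i k. l i < k \<and> k \<le> l (Suc i) \<and> g \<in> h (z (Suc i)) k"
  shows "\<exists>B. coherent (h(d := B)) d \<and>
    (\<forall>i k. l i < k \<and> k \<le> l (Suc i) \<longrightarrow> B k = insert d (h (z (Suc i)) k))"
proof -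
  obtain A where A: "\<And>i k. l i < k \<Longrightarrow> k \<le> l (Suc i) \<Longrightarrow> A k = h (z (Suc i)) k"
    using piecewise_along_strict_mono[OF l, of "\<lambda>i. h (z (Suc i))"] by blast
  have l_0: "l 0 \<le> l i" for i
    using l by (simp add: strict_mono_less_eq)
  have coh_z: "coherent h (z i)" for i
    using coh z .
  have "\<exists>B. (\<forall>k\<ge>Suc (l 0). B k = insert d (A k)) \<and> coherent (h(d := B)) d"
  proof (rule coherent_extend)
    show "coherent h g" if "g < d" for g
      using coh that .
  next
    fix k assume "Suc (l 0) \<le> k"
    then obtain i where i: "l i < k" "k \<le> l (Suc i)"
      using strict_mono_interval[OF l, of k] by (auto simp: Suc_le_eq)
    show "stem h k (A k)"
      using stem_hull[OF coh_z jumps_not_full[OF coh_z jumps i(1)]] A[OF i] by simp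
    show "A k \<subseteq> {..<d}"
      using A[OF i] coherent_le[OF coh_z] le_less_trans[OF _ z] by blast
    show "A k = trace h k (A (Suc k))"
      by (rule trace_jump_sequence[OF coh_z l jumps A i])
  next
    fix g assume "g < d"
    then obtain i k where "l i < k" "k \<le> l (Suc i)" "g \<in> h (z (Suc i)) k"
      using cover by blast
    then show "\<exists>k\<ge>Suc (l 0). g \<in> A k"
      using A[of i k] l_0[of i] by (intro exI[of _ k]) simp
  qed
  then obtain B where B: "\<And>k. Suc (l 0) \<le> k \<Longrightarrow> B k = insert d (A k)" "coherent (h(d := B)) d"
    by blast
  have "B k = insert d (h (z (Suc i)) k)" if "l i < k" "k \<le> l (Suc i)" for i k
    using B(1)[of k] A[OF that] that l_0[of i] by simp
  with B(2) show ?thesis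
    by blast
qed

lemma coherent_generic_limit:
  assumes "z0 < d" and coh: "\<And>g. g < d \<Longrightarrow> coherent h g" and \<Q>: "countable \<Q>"
    and dense: "\<And>Q. Q \<in> \<Q> \<Longrightarrow> dense_below h d Q"
    and cover: "\<And>g. g < d \<Longrightarrow> \<exists>Q\<in>\<Q>. \<forall>z k. Q z k \<longrightarrow> g \<in> h z k"
  shows "\<exists>B. coherent (h(d := B)) d \<and> (\<forall>Q\<in>\<Q>. \<exists>z k. Q z k \<and> follows (h(d := B)) d z k)"
proof -
  have "\<Q> \<noteq> {}"
    using cover[OF \<open>z0 < d\<close>] by blast
  define Q where "Q i = from_nat_into \<Q> i" for i
  have "dense_below h d (Q i)" for i
    unfolding Q_def using dense from_nat_into[OF \<open>\<Q> \<noteq> {}\<close>] .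
  from jump_sequence[of z0 d h Q, OF \<open>z0 < d\<close> this]
  obtain z l where z: "\<And>i. z i < d" and l: "strict_mono l"
    and jumps: "\<And>i. jumps h (z i) (z (Suc i)) (l i)"
    and meets: "\<And>i. \<exists>k. l i < k \<and> k < l (Suc i) \<and> Q i (z (Suc i)) k"
    by blast
  have Q_surj: "\<exists>i. Q i = P" if "P \<in> \<Q>" for P
    unfolding Q_def using from_nat_into_surj[OF \<Q> that] .
  have "\<exists>i k. l i < k \<and> k \<le> l (Suc i) \<and> g \<in> h (z (Suc i)) k" if "g < d" for g
    using cover[OF that] Q_surj meets by (metis less_imp_le)
  from coherent_jump_limit[OF coh z l jumps this]
  obtain B where B: "coherent (h(d := B)) d"
    "\<And>i k. l i < k \<Longrightarrow> k \<le> l (Suc i) \<Longrightarrow> B k = insert d (h (z (Suc i)) k)"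
    by blast
  have "\<exists>z k. P z k \<and> follows (h(d := B)) d z k" if "P \<in> \<Q>" for P
  proof -
    obtain i k where k: "l i < k" "k < l (Suc i)" "P (z (Suc i)) k"
      using Q_surj[OF \<open>P \<in> \<Q>\<close>] meets by blast
    have "\<not> full h (z (Suc i)) k"
      using jumps_not_full[OF coh[OF z] jumps k(1)] .
    then have "follows (h(d := B)) d (z (Suc i)) k"
      using B(2)[of i k] B(2)[of i "Suc k"] k(1,2) z[of "Suc i"] less_imp_neq[OF z[of "Suc i"]]
      by (simp add: follows_def full_def)
    then show ?thesis
      using k(3) by blast
  qed
  with B(1) show ?thesis
    by blast
qed

subsection \<open>Existence\<close>

lemma generic_hull_MOST_not_full:
  assumes "generic_hull T h b"
  shows "\<forall>\<^sub>\<infinity>k. \<not> full h b k"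
proof -
  obtain l where "r (Suc l) = card (h b l) + 0"
    using INFM_EX[OF generic_hull_root_size[OF assms]] by blast
  then have "\<not> full h b l"
    using root_less_m[of l] by (simp add: full_def)
  then show ?thesis
    using not_full_mono[OF generic_hull_coherent[OF assms]] by (auto simp: MOST_nat_le)
qed

lemma full_hull_exists:
  assumes generic: "\<And>x. x \<in> D \<Longrightarrow> generic_hull T h x" and succ: "\<And>x. x \<in> D \<Longrightarrow> \<exists>x'\<in>D. is_succ x x'"
    and "y \<in> D"
  shows "\<exists>z\<in>D. y \<in> h z k \<and> full h z k"
  using \<open>y \<in> D\<close>
proof (induction "m k - card (h y k)" arbitrary: y rule: less_induct)
  case less
  have coh_y: "coherent h y"
    using generic_hull_coherent generic less.prems by blast
  show ?case
  proof (cases "full h y k")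
    case True
    then show ?thesis
      using less.prems coherent_self[OF coh_y] by blast
  next
    case False
    obtain y' where y': "y' \<in> D" "is_succ y y'"
      using succ less.prems by blast
    have follows: "follows h y' y k"
      using generic_hull_follows[OF generic[OF y'(1)] y'(2) False] .
    obtain z where z: "z \<in> D" "y' \<in> h z k" "full h z k"
      using less.hyps[of y'] y'(1) not_full_less[OF coh_y False] follows_card(1)[OF coh_y follows]
      by (metis diff_less_mono2 lessI)
    have "y \<in> h y' k"
      using follows coherent_self[OF coh_y] by (simp add: follows_def)
    then have "y \<in> h z k"
      using coherent_sub[OF generic_hull_coherent[OF generic[OF z(1)]] z(2)] by blast
    then show ?thesis
      using z by blast
  qed
qed

lemma full_hull_below:
  assumes lim: "is_lim d" and generic: "\<And>x. x < d \<Longrightarrow> generic_hull T h x" and "y < d"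
  shows "\<exists>z<d. y \<in> h z k \<and> full h z k"
proof -
  have "\<exists>z\<in>{..<d}. y \<in> h z k \<and> full h z k"
    using generic is_lim_succ_less[OF lim] \<open>y < d\<close> by (intro full_hull_exists[of _ T]) auto
  then show ?thesis
    by auto
qed

lemma jump_past:
  assumes lim: "is_lim d" and generic: "\<And>x. x < d \<Longrightarrow> generic_hull T h x" and "a < d" "z < d"
  shows "\<exists>z'<d. a < z' \<and> (\<exists>l>N. jumps h z z' l)"
proof -
  obtain y where y: "y < d" "a < y" "z < y"
    using is_lim_finite_bound[OF lim, of "{a, z}"] \<open>a < d\<close> \<open>z < d\<close> by auto
  obtain l where l: "N < l" "branches_off h z y l"
    using generic_hull_branches_off[OF generic[OF y(1)] y(3)] by (auto simp: INFM_nat)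
  obtain z' where z': "z' < d" "y \<in> h z' l" "full h z' l"
    using full_hull_below[OF lim generic y(1)] by blast
  have coh_z': "coherent h z'"
    using generic_hull_coherent[OF generic[OF z'(1)]] .
  have "jumps h z z' l"
    using branches_off_upward[OF coh_z' z'(2) l(2)] z'(3) by (simp add: jumps_def)
  moreover have "a < z'"
    using y(2) coherent_le[OF coh_z' z'(2)] by simp
  ultimately show ?thesis
    using z'(1) l(1) by blast
qed

lemma dense_below_INFM:
  assumes lim: "is_lim d" and generic: "\<And>x. x < d \<Longrightarrow> generic_hull T h x" and "a < d"
    and infinitely_often: "\<And>z. a < z \<Longrightarrow> z < d \<Longrightarrow> \<exists>\<^sub>\<infinity>k. P z k"
  shows "dense_below h d (\<lambda>z k. K < k \<and> P z k)"
  unfolding dense_below_def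
proof (intro allI impI)
  fix z N assume "z < d"
  obtain z' l where z': "z' < d" "a < z'" and l: "N < l" "jumps h z z' l"
    using jump_past[OF lim generic \<open>a < d\<close> \<open>z < d\<close>] by blast
  obtain k where "max K l < k" "P z' k"
    using infinitely_often[OF z'(2,1)] unfolding INFM_nat by blast
  then show "\<exists>z'<d. \<exists>l>N. jumps h z z' l \<and> (\<exists>k>l. K < k \<and> P z' k)"
    using z'(1) l by auto
qed

lemma occupies_restrict:
  assumes coh_f: "coherent h f" and t: "occupies h k t f"
    and e: "e \<in> h f (Suc k)" "length t < xi h k e"
  shows "occupies h k t e"
  unfolding occupies_def
proof (intro allI impI ballI)
  fix i v assume "i < length t" "v \<in> t ! i"
  then have v: "v \<in> h f (Suc k)" "xi h k v = Suc i" "xi h k v < xi h k e"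
    using t e(2) by (auto simp: occupies_def)
  have "v < e"
    using xi_less_imp_less[OF coherent_hull_closed[OF coh_f] v(1) e(1) v(3)] .
  then show "v \<le> e \<and> v \<in> h e (Suc k) \<and> xi h k v = Suc i"
    using v coherent_restrict[OF coh_f e(1)] by auto
qed

lemma occupies_upward:
  assumes coh: "coherent h f" "e \<in> h f (Suc k)" and t: "occupies h k t e"
  shows "occupies h k t f"
  unfolding occupies_def
proof (intro allI impI ballI)
  fix i v assume "i < length t" "v \<in> t ! i"
  then have "v \<in> h f (Suc k)" "xi h k v = Suc i"
    using t coherent_sub[OF coh] by (auto simp: occupies_def)
  then show "v \<le> f \<and> v \<in> h f (Suc k) \<and> xi h k v = Suc i"
    using coherent_le[OF coh(1)] by blast
qed

lemma catches_same_piece: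
  assumes coh_f: "coherent h f" and e: "e \<in> h f k" "occupies h k t e" "xi h k e = Suc (length t)"
    and coh: "coherent h z" "z \<in> h f k"
    and y: "root_ends_at h y z k" "reachable h Z K k y" and "K < k"
  shows "catches h t Z K z k"
proof -
  have "xi h k z = xi h k f"
    using root_ends_at_xi_pos[OF coh(1) y(1)] coherent_xi[OF coh_f coh(2)] by auto
  moreover have "xi h k e = xi h k f"
    using e(3) coherent_xi[OF coh_f e(1)] by auto
  ultimately have xi: "xi h k z = Suc (length t)"
    using e(3) by simp
  have sub: "h f k \<subseteq> h f (Suc k)"
    using coherent_mono[OF coh_f] by simp
  then have "occupies h k t f"
    using occupies_upward[OF coh_f _ e(2)] e(1) by blast
  then have "occupies h k t z"
    using occupies_restrict[OF coh_f] coh(2) sub xi by auto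
  then show ?thesis
    using y xi \<open>K < k\<close> by (auto simp: catches_def)
qed

lemma full_hull_past:
  assumes lim: "is_lim d" and generic: "\<And>x. x < d \<Longrightarrow> generic_hull T h x" and "e < d" "y \<in> h e k"
    and l: "l < k" "branches_off h z y l" "\<not> full h y l"
  obtains f z' where "f < d" "e \<in> h f k" "z' \<in> h f k" "y < z'" "y \<in> h z' k" "jumps h z z' l"
proof -
  have coh: "\<And>x. x < d \<Longrightarrow> coherent h x"
    using generic generic_hull_coherent by blast
  obtain f where f: "f < d" "e \<in> h f k" "full h f k"
    using full_hull_below[OF lim generic \<open>e < d\<close>] by blast
  have "y \<in> h f k"
    using coherent_sub[OF coh[OF f(1)] f(2)] \<open>y \<in> h e k\<close> by blast
  moreover have "coherent h x" if "x \<le> f" for x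
    using coh that f(1) by (meson le_less_trans)
  ultimately obtain z' where z': "z' \<in> h f k" "y \<in> h z' l" "full h z' l"
    using full_hull_within[of f h k y l] f(3) l(1) by (meson less_imp_le)
  have coh_z': "coherent h z'"
    using coh f(1) coherent_le[OF coh[OF f(1)] z'(1)] by simp
  have "jumps h z z' l"
    using branches_off_upward[OF coh_z' z'(2) l(2)] z'(3) by (simp add: jumps_def)
  moreover have "y \<noteq> z'"
    using z'(3) l(3) by blast
  then have "y < z'" "y \<in> h z' k"
    using coherent_le[OF coh_z' z'(2)] coherent_mono[OF coh_z', of l k] z'(2) l(1) by auto
  ultimately show ?thesis
    using that f(1,2) z'(1) by blast
qed

text \<open>The new point stops following \<open>z\<close> and follows \<open>z'\<close>, which lies in the piece next to the caught
  tuple; hence so will the new point.\<close>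

lemma dense_below_catches:
  assumes lim: "is_lim d" and generic: "\<And>x. x < d \<Longrightarrow> generic_hull T h x"
    and S: "caught_below h S d" and Z: "finite Z" "Z \<subseteq> {..<d}"
  shows "dense_below h d (\<lambda>z k. \<exists>t\<in>S. catches h t Z K z k)"
  unfolding dense_below_def
proof (intro allI impI)
  fix z N assume "z < d"
  have coh: "\<And>x. x < d \<Longrightarrow> coherent h x"
    using generic generic_hull_coherent by blast
  have "finite (insert z Z) \<and> insert z Z \<subseteq> {..<d}"
    using Z \<open>z < d\<close> by simp
  from S[unfolded caught_below_def, rule_format, OF this, of "max K N"]
  obtain e k t where "e < d" "t \<in> S" and t: "catches h t (insert z Z) (max K N) e k"
    by blast
  then obtain y where y: "root_ends_at h y e k" "reachable h (insert z Z) (max K N) k y"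
    by (auto simp: catches_def)
  obtain l where l: "max K N < l" "l < k" "branches_off h z y l" "\<not> full h y l"
    using y(2) by (auto simp: reachable_def)
  have "y \<in> h e k"
    using y(1) by (simp add: root_ends_at_def)
  then obtain f z' where f: "f < d" "e \<in> h f k"
      and z': "z' \<in> h f k" "y < z'" "y \<in> h z' k" "jumps h z z' l"
    using full_hull_past[OF lim generic \<open>e < d\<close> _ l(2-4)] by blast
  have "z' < d"
    using coherent_le[OF coh[OF f(1)] z'(1)] f(1) by simp
  have "catches h t Z K z' k"
  proof (rule catches_same_piece[OF coh[OF f(1)] f(2) _ _ coh[OF \<open>z' < d\<close>] z'(1)])
    show "occupies h k t e" "xi h k e = Suc (length t)" "K < k"
      using t by (auto simp: catches_def)
    show "root_ends_at h y z' k"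
      using y(1) z'(2,3) by (simp add: root_ends_at_def)
    show "reachable h Z K k y"
      using y(2) by (auto simp: reachable_def)
  qed
  then show "\<exists>z'<d. \<exists>l>N. jumps h z z' l \<and> (\<exists>k>l. \<exists>t\<in>S. catches h t Z K z' k)"
    using \<open>z' < d\<close> \<open>t \<in> S\<close> z'(4) l(1,2) by (meson max_less_iff_conj)
qed

inductive limit_requirement ::
  "(nat \<Rightarrow> 'a::wellorder \<Rightarrow> 'a set list set) \<Rightarrow> 'a hulls \<Rightarrow> 'a \<Rightarrow> ('a \<Rightarrow> nat \<Rightarrow> bool) \<Rightarrow> bool"
  for T h d where
  root_size: "limit_requirement T h d (\<lambda>z k. K < k \<and> r (Suc k) = card (h z k) + Suc j)"
| branching: "a < d \<Longrightarrow> limit_requirement T h d (\<lambda>z k. K < k \<and> branches_off h a z k)"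
| catching: "caught_below h (T s d) d \<Longrightarrow> finite Z \<Longrightarrow> Z \<subseteq> {..<d} \<Longrightarrow>
    limit_requirement T h d (\<lambda>z k. \<exists>t\<in>T s d. catches h t Z K z k)"

lemma countable_limit_requirement:
  assumes countable: "countable {..<d}"
  shows "countable {Q. limit_requirement T h d Q}"
proof (rule countable_subset)
  let ?root_size = "\<lambda>(K, j) z k. K < k \<and> r (Suc k) = card (h z k) + Suc j"
  let ?branching = "\<lambda>(a, K) z k. K < k \<and> branches_off h a z k"
  let ?catching = "\<lambda>(s, Z, K) z k. \<exists>t\<in>T s d. catches h t Z K z k"
  let ?Zs = "{Z. finite Z \<and> Z \<subseteq> {..<d}}"
  show "{Q. limit_requirement T h d Q} \<subseteq>
      range ?root_size \<union> ?branching ` ({..<d} \<times> UNIV) \<union> ?catching ` (UNIV \<times> ?Zs \<times> UNIV)"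
  proof
    fix Q assume "Q \<in> {Q. limit_requirement T h d Q}"
    then have "limit_requirement T h d Q"
      by simp
    then show "Q \<in> range ?root_size \<union> ?branching ` ({..<d} \<times> UNIV) \<union> ?catching ` (UNIV \<times> ?Zs \<times> UNIV)"
    proof cases
      case (root_size K j)
      then show ?thesis
        by (intro UnI1 image_eqI[of _ _ "(K, j)"]) simp_all
    next
      case (branching a K)
      then show ?thesis
        by (intro UnI1[OF UnI2] image_eqI[of _ _ "(a, K)"]) simp_all
    next
      case (catching s Z K)
      then show ?thesis
        by (intro UnI2 image_eqI[of _ _ "(s, Z, K)"]) simp_all
    qed
  qed
  show "countable (range ?root_size \<union> ?branching ` ({..<d} \<times> UNIV) \<union> ?catching ` (UNIV \<times> ?Zs \<times> UNIV))"
    using countable countable_Collect_finite_subset[OF countable]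
    by (intro countable_Un countable_image countable_SIGMA) auto
qed

lemma dense_below_limit_requirement:
  assumes lim: "is_lim d" and generic: "\<And>x. x < d \<Longrightarrow> generic_hull T h x"
    and "limit_requirement T h d Q"
  shows "dense_below h d Q"
  using assms(3)
proof cases
  case (root_size K j)
  obtain x where "x < d"
    using lim is_lim_def by blast
  then show ?thesis
    unfolding root_size by (intro dense_below_INFM[OF lim generic] generic_hull_root_size[OF generic])
next
  case (branching a K)
  show ?thesis
    unfolding branching(1)
    by (intro dense_below_INFM[OF lim generic branching(2)] generic_hull_branches_off[OF generic])
next
  case (catching s Z K)
  show ?thesis
    unfolding catching(1) by (rule dense_below_catches[OF lim generic catching(2-4)])
qed

lemma coherent_limit:
  assumes lim: "is_lim d" and generic: "\<And>x. x < d \<Longrightarrow> generic_hull T h x"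
    and countable: "countable {..<d}"
  shows "\<exists>B. coherent (h(d := B)) d \<and>
    (\<forall>Q. limit_requirement T h d Q \<longrightarrow> (\<exists>z k. Q z k \<and> follows (h(d := B)) d z k))"
proof -
  obtain x where "x < d"
    using lim is_lim_def by blast
  then have "\<exists>B. coherent (h(d := B)) d \<and>
      (\<forall>Q\<in>{Q. limit_requirement T h d Q}. \<exists>z k. Q z k \<and> follows (h(d := B)) d z k)"
  proof (rule coherent_generic_limit)
    show "coherent h g" if "g < d" for g
      using generic_hull_coherent[OF generic[OF that]] .
    show "countable {Q. limit_requirement T h d Q}"
      by (rule countable_limit_requirement[OF countable])
    show "dense_below h d Q" if "Q \<in> {Q. limit_requirement T h d Q}" for Q
      using dense_below_limit_requirement[OF lim generic] that by simp
    show "\<exists>Q\<in>{Q. limit_requirement T h d Q}. \<forall>z k. Q z k \<longrightarrow> g \<in> h z k" if "g < d" for g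
      using limit_requirement.branching[OF that, where K = 0]
      by (intro bexI[of _ "\<lambda>z k. 0 < k \<and> branches_off h g z k"])
        (auto simp: branches_off_def root_ends_at_def)
  qed
  then show ?thesis
    by simp
qed

lemma generic_hull_limit:
  assumes lim: "is_lim d" and generic: "\<And>x. x < d \<Longrightarrow> generic_hull T h x"
    and countable: "countable {..<d}"
  shows "\<exists>B. generic_hull T (h(d := B)) d"
proof -
  obtain B where B: "coherent (h(d := B)) d"
    and meets: "\<And>Q. limit_requirement T h d Q \<Longrightarrow> \<exists>z k. Q z k \<and> follows (h(d := B)) d z k"
    using coherent_limit[OF lim _ countable] generic by blast
  let ?h = "h(d := B)"
  have coh_z: "coherent h z" if "follows ?h d z k" for z k
    using generic_hull_coherent[OF generic] that by (simp add: follows_def)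
  have below: "caught_below ?h S d \<longleftrightarrow> caught_below h S d" for S
    by (rule caught_below_cong) auto
  have "\<exists>k>K. r (Suc k) = card (B k) + j" for j K
    using meets[OF limit_requirement.root_size[where K = K and j = j]] follows_update_card[OF coh_z]
    by fastforce
  moreover have "\<exists>k>K. branches_off ?h a d k" if "a < d" for a K
    using meets[OF limit_requirement.branching[OF that, where K = K]] follows_update_branches_off[OF coh_z]
    by blast
  moreover have "\<exists>k. \<exists>t\<in>T s d. catches ?h t Z K d k"
    if "caught_below ?h (T s d) d" "finite Z" "Z \<subseteq> {..<d}" for s Z K
    using meets[OF limit_requirement.catching[where s = s and Z = Z and K = K]] that below follows_update_catches[OF coh_z]
    by blast
  ultimately have "generic_hull T ?h d"
    unfolding generic_hull_def caught_by_def INFM_nat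
    using B is_lim_imp_not_is_succ[OF lim] by (intro conjI allI impI) auto
  then show ?thesis
    by blast
qed

lemma successor_branches_off:
  assumes b: "generic_hull T h b" and f: "\<forall>\<^sub>\<infinity>k. follows (h(d := B)) d b k" and "a \<le> b"
  shows "\<exists>\<^sub>\<infinity>k. branches_off (h(d := B)) a d k"
proof (cases "a = b")
  case True
  have "\<exists>\<^sub>\<infinity>k. r (Suc k) = card (h b k) + 0 \<and> follows (h(d := B)) d b k"
    using generic_hull_root_size[OF b] f by (rule INFM_conjI)
  then show ?thesis
    unfolding True
    by (rule INFM_mono) (use follows_update_self[OF generic_hull_coherent[OF b]] in auto)
next
  case False
  then have "a < b"
    using \<open>a \<le> b\<close> by simp
  then have "\<exists>\<^sub>\<infinity>k. branches_off h a b k \<and> follows (h(d := B)) d b k"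
    using generic_hull_branches_off[OF b] f by (intro INFM_conjI)
  then show ?thesis
    by (rule INFM_mono) (blast intro: follows_update_branches_off[OF generic_hull_coherent[OF b]])
qed

lemma generic_hull_successor:
  assumes succ: "is_succ b d" and generic: "\<And>x. x < d \<Longrightarrow> generic_hull T h x"
  shows "\<exists>B. generic_hull T (h(d := B)) d"
proof -
  have b_less_d: "b < d"
    using succ by (simp add: is_succ_def)
  have generic_b: "generic_hull T h b" and coh_b: "coherent h b"
    using generic b_less_d generic_hull_coherent by blast+
  obtain B where B: "coherent (h(d := B)) d" "\<And>k. \<not> full h b k \<Longrightarrow> follows (h(d := B)) d b k"
    using coherent_successor[OF succ] generic_hull_coherent[OF generic] generic_hull_MOST_not_full[OF generic_b]
    by blast
  let ?h = "h(d := B)"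
  have f: "\<forall>\<^sub>\<infinity>k. follows ?h d b k"
    using generic_hull_MOST_not_full[OF generic_b] B(2) by (rule MOST_mono)
  have "generic_hull T ?h d"
    unfolding generic_hull_def
  proof (intro conjI allI impI)
    show "coherent ?h d"
      by (rule B(1))
    show "\<exists>\<^sub>\<infinity>k. r (Suc k) = card (?h d k) + j" for j
      using INFM_conjI[OF generic_hull_root_size[OF generic_b, of "Suc j"] f]
      by (rule INFM_mono) (use follows_update_card[OF coh_b] in auto)
    show "\<exists>\<^sub>\<infinity>k. branches_off ?h a d k" if "a < d" for a
      using successor_branches_off[OF generic_b f is_succ_le[OF succ that]] .
    show "follows ?h d b' k" if "is_succ b' d \<and> \<not> full ?h b' k" for b' k
    proof -
      have "b' = b"
        using that succ is_succ_unique by blast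
      then show ?thesis
        using that B(2)[of k] less_imp_neq[OF b_less_d] by (auto simp: full_def)
    qed
    show "caught_by ?h (T s d) d" if "is_lim d \<and> caught_below ?h (T s d) d" for s
      using that succ is_lim_imp_not_is_succ by blast
  qed
  then show ?thesis
    by blast
qed

lemma good_type_INFM:
  assumes "good_type m n r"
  shows "\<exists>\<^sub>\<infinity>k. r (Suc k) = x"
proof -
  have "\<exists>\<^sub>\<infinity>k. k \<ge> 1 \<and> r k = x"
    using assms by (simp add: good_type_def INFM_iff_infinite)
  then show ?thesis
    unfolding INFM_nat by (metis Suc_le_D Suc_less_eq One_nat_def)
qed

lemma generic_hull_least:
  assumes "good_type m n r" and least: "\<And>x. \<not> x < d"
  shows "\<exists>B. generic_hull T (h(d := B)) d"
proof -
  have m_pos: "0 < m k" for k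
    using root_less_m[of k] by simp
  have "\<exists>B. (\<forall>k\<ge>0. B k = insert d {}) \<and> coherent (h(d := B)) d"
    using least m_pos
    by (intro coherent_extend[where A = "\<lambda>_. {}"])
      (auto simp: stem_def hull_closed_def trace_def piece_def)
  then obtain B where B: "\<And>k. B k = {d}" "coherent (h(d := B)) d"
    by auto
  have "\<exists>\<^sub>\<infinity>k. r (Suc k) = card ((h(d := B)) d k) + j" for j
    using good_type_INFM[OF assms(1), of "Suc j"] B(1) by simp
  then have "generic_hull T (h(d := B)) d"
    using B least by (auto simp: generic_hull_def is_succ_def is_lim_def)
  then show ?thesis
    by blast
qed

theorem generic_hulls_exist:
  fixes T :: "nat \<Rightarrow> 'a::wellorder \<Rightarrow> 'a set list set"
  assumes good: "good_type m n r" and countable: "\<And>x::'a. countable {..<x}"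
  shows "\<exists>h. \<forall>d. generic_hull T h d"
proof -
  have "\<exists>h. \<forall>d. generic_hull T (h(d := h d)) d"
  proof (rule dependent_wellorder_choice[where P = "\<lambda>h d B. generic_hull T (h(d := B)) d"])
    show "generic_hull T (f(d := B)) d = generic_hull T (g(d := B)) d"
      if "\<And>y. y < d \<Longrightarrow> f y = g y" for B f g d
      using that by (intro generic_hull_cong) auto
  next
    fix d f assume "\<And>y. y < d \<Longrightarrow> generic_hull T (f(y := f y)) y"
    then have generic: "\<And>y. y < d \<Longrightarrow> generic_hull T f y"
      by simp
    consider (least) "\<forall>x. \<not> x < d" | (successor) b where "is_succ b d" | (limit) "is_lim d"
      using is_lim_or_succ by blast
    then show "\<exists>B. generic_hull T (f(d := B)) d"
    proof cases
      case least
      then show ?thesis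
        using generic_hull_least[OF good] by blast
    next
      case successor
      then show ?thesis
        using generic_hull_successor generic by blast
    next
      case limit
      then show ?thesis
        using generic_hull_limit[OF _ generic countable] by blast
    qed
  qed
  then show ?thesis
    by simp
qed

section \<open>The scheme of full hulls\<close>

definition hull_family :: "'a::wellorder hulls \<Rightarrow> 'a set set" where
  "hull_family h = {h b k | b k. full h b k}"

lemma level_hull_family: "level m (hull_family h) k = {h b k | b. full h b k}"
  unfolding level_def hull_family_def full_def using strict_mono_eq[OF strict_mono_m] by auto

lemma card_root:
  assumes coh_b: "coherent h b" and full: "full h b (Suc k)"
  shows "card (piece h k (h b (Suc k)) 0) = r (Suc k)"
proof -
  have "r (Suc k) \<le> card (h b (Suc k))"
    using full m_Suc[of k] by (simp add: full_def)
  then have "{p \<in> {1..card (h b (Suc k))}. block k p \<in> {0, 0}} = {1..r (Suc k)}"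
    by (auto simp: block_eq_0_iff)
  then show ?thesis
    unfolding card_piece[OF coherent_hull_closed[OF coh_b]] by simp
qed

lemma decomp_hull:
  assumes coh: "\<And>x. coherent h x" and full: "full h b (Suc k)"
  shows "decomp m n r (hull_family h) k (h b (Suc k)) (piece h k (h b (Suc k)) 0)
    (\<lambda>i. piece h k (h b (Suc k)) (Suc i))"
proof -
  let ?F = "h b (Suc k)"
  let ?R = "piece h k ?F 0" and ?Fs = "\<lambda>i. piece h k ?F (Suc i)"
  note less = xi_less_imp_less[OF coherent_hull_closed[OF coh]]
  have "x \<in> (\<Union>i<n (Suc k). ?Fs i)" if x: "x \<in> ?F" for x
  proof (cases "xi h k x")
    case 0
    then show ?thesis
      using x n_ge_2[of k] by (intro UN_I[of 0]) (auto simp: piece_def)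
  next
    case (Suc i)
    then show ?thesis
      using x xi_le_n[OF coh, of k x] by (intro UN_I[of i]) (auto simp: piece_def)
  qed
  then have "?F = (\<Union>i<n (Suc k). ?Fs i)"
    by (auto simp: piece_def)
  moreover have "?Fs i \<in> level m (hull_family h) k" if "i < n (Suc k)" for i
    using full_piece[OF coh full, of "Suc i"] that unfolding level_hull_family
    by (auto simp: Suc_le_eq)
  moreover have "?Fs i \<inter> ?Fs j = ?R" if "i \<noteq> j" for i j
    using that by (auto simp: piece_def)
  moreover have "setless ?R (?Fs 0 - ?R)" "setless (?Fs i - ?R) (?Fs (Suc i) - ?R)" for i
    unfolding setless_def by (auto simp: piece_def intro!: less)
  ultimately show ?thesis
    unfolding decomp_def using card_root[OF coh full] by blast
qed

lemma hull_family_cofinal: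
  fixes h :: "'a::wellorder hulls"
  assumes generic: "\<And>x. generic_hull T h x" and succ: "\<And>x::'a. \<exists>y. is_succ x y" and A: "finite A"
  shows "\<exists>F\<in>hull_family h. A \<subseteq> F"
proof -
  have coh: "coherent h x" for x
    using generic generic_hull_coherent by blast
  define b where "b = (if A = {} then undefined else Max A)"
  have "A \<subseteq> {..b}"
    using A by (auto simp: b_def)
  then obtain k where k: "A \<subseteq> h b k"
    using coherent_subset_MOST[OF coh A, of b] by (auto simp: MOST_nat_le)
  obtain z where z: "b \<in> h z k" "full h z k"
    using full_hull_exists[of UNIV T h b k] generic succ by auto
  then show ?thesis
    using k coherent_sub[OF coh z(1)] unfolding hull_family_def by blast
qed

lemma hull_family_init_seg:
  assumes coh: "\<And>x. coherent h x" and E: "E \<in> level m (hull_family h) k"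
    and F: "F \<in> level m (hull_family h) k"
  shows "init_seg (E \<inter> F) E"
proof -
  obtain b b' where E: "E = h b k" and F: "F = h b' k"
    using E F unfolding level_hull_family by blast
  have "E \<inter> {..x} = F \<inter> {..x}" if "x \<in> E \<inter> F" for x
    using coherent_restrict[OF coh, of x b k] coherent_restrict[OF coh, of x b' k] that E F by blast
  then show ?thesis
    unfolding init_seg_def by (auto intro: less_imp_le)
qed

lemma construction_scheme_hull_family:
  fixes h :: "'a::wellorder hulls"
  assumes generic: "\<And>x. generic_hull T h x" and succ: "\<And>x::'a. \<exists>y. is_succ x y"
  shows "construction_scheme m n r UNIV (hull_family h)"
proof -
  have coh: "coherent h x" for x
    using generic generic_hull_coherent by blast
  have "F \<noteq> {} \<and> finite F \<and> F \<subseteq> UNIV \<and> (\<exists>k. card F = m k)" if F: "F \<in> hull_family h" for F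
  proof -
    obtain b k where "F = h b k" "full h b k"
      using F unfolding hull_family_def by blast
    then show ?thesis
      using coherent_self[OF coh, of b k] coherent_finite[OF coh, of b k] by (auto simp: full_def)
  qed
  moreover have "\<exists>R Fs. decomp m n r (hull_family h) k F R Fs"
      if "F \<in> level m (hull_family h) (Suc k)" for k F
    using that decomp_hull[OF coh] unfolding level_hull_family by blast
  moreover have "init_seg (E \<inter> F) E \<and> init_seg (E \<inter> F) F"
    if "E \<in> level m (hull_family h) k" "F \<in> level m (hull_family h) k" for k E F
    using hull_family_init_seg[OF coh that] hull_family_init_seg[OF coh that(2,1)]
    by (simp add: Int_commute)
  moreover have "\<exists>F\<in>hull_family h. A \<subseteq> F" if "finite A" for A
    using hull_family_cofinal[OF generic succ that] .
  ultimately show ?thesis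
    by (simp add: construction_scheme_def)
qed

lemma Xi_is_hull:
  assumes coh: "\<And>x. coherent h x" and full: "full h b (Suc k)" and x: "x \<in> h b (Suc k)"
  shows "Xi_is m n r (hull_family h) x (Suc k) (int (xi h k x) - 1)"
proof -
  let ?F = "h b (Suc k)" and ?i = "int (xi h k x) - 1"
  have "?F \<in> level m (hull_family h) (Suc k)"
    unfolding level_hull_family using full by blast
  moreover have "(x \<in> piece h k ?F 0 \<and> ?i = - 1) \<or>
      (x \<notin> piece h k ?F 0 \<and> ?i \<ge> 0 \<and> x \<in> piece h k ?F (Suc (nat ?i)))"
    using x by (cases "xi h k x") (auto simp: piece_def)
  ultimately show ?thesis
    unfolding Xi_is_def using decomp_hull[OF coh full] x by auto
qed

lemma rho_hull:
  assumes coh: "\<And>x. coherent h x" and full: "full h b (Suc k)"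
    and xy: "x \<in> h b (Suc k)" "y \<in> h b (Suc k)" "xi h k x \<noteq> xi h k y" "xi h k x \<noteq> 0" "xi h k y \<noteq> 0"
  shows "rho m (hull_family h) x y = Suc k"
  unfolding rho_def
proof (rule Least_equality)
  show "\<exists>F\<in>level m (hull_family h) (Suc k). {x, y} \<subseteq> F"
    unfolding level_hull_family using full xy by blast
next
  fix l assume "\<exists>F\<in>level m (hull_family h) l. {x, y} \<subseteq> F"
  then obtain g where g: "x \<in> h g l" "y \<in> h g l"
    unfolding level_hull_family by blast
  show "Suc k \<le> l"
  proof (rule ccontr)
    assume "\<not> Suc k \<le> l"
    then have "h g l \<subseteq> h g k"
      using coherent_mono[OF coh] by simp
    then have "xi h k x \<in> {0, xi h k g}" "xi h k y \<in> {0, xi h k g}"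
      using coherent_xi[OF coh] g by blast+
    then show False
      using xy by auto
  qed
qed

lemma rtt_delta_hull:
  assumes coh_f: "coherent h f" and t: "occupies h k t f" "set t \<subseteq> tails \<S> R q" "2 \<le> length t"
    and R: "finite R" "R \<subseteq> piece h k (h f (Suc k)) 0"
  shows "rtt_delta (\<lambda>i. R \<union> t ! i) (length t) (card R + q) R"
proof -
  have tail: "finite (t ! i)" "card (t ! i) = q" "setless R (t ! i)" if "i < length t" for i
    using t(2) nth_mem[OF that] by (auto simp: tails_def)
  have xi_t: "v \<in> h f (Suc k) \<and> xi h k v = Suc i" if "i < length t" "v \<in> t ! i" for i v
    using t(1) that by (auto simp: occupies_def)
  have xi_R: "xi h k v = 0" if "v \<in> R" for v
    using R(2) that by (auto simp: piece_def)
  have R_t: "R \<inter> t ! i = {}" if "i < length t" for i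
    using xi_R xi_t[OF that] by fastforce
  then have "card (R \<union> t ! i) = card R + q" "(R \<union> t ! i) - R = t ! i" if "i < length t" for i
    using that tail[OF that] R(1) by (auto simp: card_Un_disjoint)
  moreover have "(R \<union> t ! i) \<inter> (R \<union> t ! j) = R" if "i < length t" "j < length t" "i \<noteq> j" for i j
    using xi_t[OF that(1)] xi_t[OF that(2)] that(3) by fastforce
  moreover have "setless (t ! i) (t ! Suc i)" if "Suc i < length t" for i
    unfolding setless_def
  proof (intro ballI)
    fix v w assume "v \<in> t ! i" "w \<in> t ! Suc i"
    then show "v < w"
      using xi_t[of i v] xi_t[of "Suc i" w] that
      by (intro xi_less_imp_less[OF coherent_hull_closed[OF coh_f]]) auto
  qed
  ultimately show ?thesis
    using t(3) R(1) tail by (simp add: rtt_delta_def)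
qed

lemma rho_captured_hull:
  assumes coh: "\<And>x. coherent h x" and full: "full h f (Suc k)"
    and t: "occupies h k t f" "set t \<subseteq> tails \<S> R q" "2 \<le> length t"
    and R: "finite R" "R \<subseteq> piece h k (h f (Suc k)) 0" and "q > 0"
  shows "rho_captured m n r (hull_family h) (\<lambda>i. R \<union> t ! i) (length t) (Suc k)"
proof -
  let ?x = "\<lambda>i a. elem (R \<union> t ! i) a"
  have x: "?x i a \<in> h f (Suc k) \<and> xi h k (?x i a) = (if a < card R then 0 else Suc i)"
    if "i < length t" "a < card R + q" for i a
  proof -
    have "finite (t ! i)" "card (t ! i) = q" "setless R (t ! i)"
      using t(2) nth_mem[OF that(1)] by (auto simp: tails_def)
    then have "?x i a \<in> (if a < card R then R else t ! i)"
      using elem_setless_Un[OF R(1)] that(2) by blast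
    then show ?thesis
      using t(1) R(2) that(1) by (auto simp: occupies_def piece_def split: if_splits)
  qed
  have "xi h k (?x (length t - 1) (card R)) = length t"
    using x[of "length t - 1" "card R"] t(3) \<open>q > 0\<close> by simp
  then have "length t \<le> n (Suc k)"
    using xi_le_n[OF coh] by metis
  moreover have "Xi_is m n r (hull_family h) (?x i a) (Suc k) (if a < card R then - 1 else int i)"
    if "i < length t" "a < card R + q" for i a
    using Xi_is_hull[OF coh full] x[OF that] by (cases "a < card R") force+
  moreover have "rho m (hull_family h) (?x i a) (?x j a) = Suc k"
    if "i < j" "j < length t" "card R \<le> a" "a < card R + q" for i j a
    using x[of i a] x[of j a] that by (intro rho_hull[OF coh full]) auto
  ultimately show ?thesis
    unfolding rho_captured_def using rtt_delta_hull[OF coh t R]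
    by (intro conjI exI[of _ "card R + q"] exI[of _ R]) auto
qed

section \<open>Iterated guessing\<close>

lemma reachable_MOST:
  assumes y: "generic_hull T h y" and Z: "finite Z" "Z \<subseteq> {..<y}"
  shows "\<forall>\<^sub>\<infinity>k. reachable h Z K k y"
proof -
  have "\<forall>\<^sub>\<infinity>k. \<exists>l. K < l \<and> l < k \<and> branches_off h z y l \<and> \<not> full h y l" if "z \<in> Z" for z
  proof -
    have "z < y"
      using that Z(2) by auto
    have "\<exists>\<^sub>\<infinity>l. branches_off h z y l \<and> \<not> full h y l"
      by (rule INFM_conjI[OF generic_hull_branches_off[OF y \<open>z < y\<close>] generic_hull_MOST_not_full[OF y]])
    then obtain l where "K < l" "branches_off h z y l" "\<not> full h y l"
      unfolding INFM_nat by blast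
    then show ?thesis
      unfolding MOST_nat by blast
  qed
  then have "\<forall>\<^sub>\<infinity>k. \<forall>z\<in>Z. \<exists>l. K < l \<and> l < k \<and> branches_off h z y l \<and> \<not> full h y l"
    using Z(1) by (simp add: eventually_ball_finite)
  then show ?thesis
    by (simp add: reachable_def)
qed

lemma caught_below_Nil:
  assumes lim: "is_lim d" and generic: "\<And>x. x < d \<Longrightarrow> generic_hull T h x"
  shows "caught_below h {[]} d"
  unfolding caught_below_def
proof (intro allI impI)
  fix Z K assume Z: "finite Z \<and> Z \<subseteq> {..<d}"
  obtain y where y: "y < d" "Z \<subseteq> {..<y}"
    using is_lim_finite_bound[OF lim] Z by blast
  obtain e where e: "is_succ y e" "e < d"
    using is_lim_succ_less[OF lim y(1)] by blast
  then have "y < e"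
    by (simp add: is_succ_def)
  have "\<forall>\<^sub>\<infinity>k. reachable h Z K k y"
    using reachable_MOST[OF generic[OF y(1)] _ y(2)] Z by blast
  then obtain K' where K': "\<And>k. K' < k \<Longrightarrow> reachable h Z K k y"
    unfolding MOST_nat by blast
  obtain k where "branches_off h y e k" "max K K' < k"
    using generic_hull_branches_off[OF generic[OF e(2)] \<open>y < e\<close>] unfolding INFM_nat by blast
  moreover from this have "reachable h Z K k y" "K < k"
    using K' by simp_all
  ultimately have "catches h [] Z K e k"
    by (auto simp: catches_def occupies_def branches_off_def)
  then show "\<exists>e<d. \<exists>k. \<exists>t\<in>{[]}. catches h t Z K e k"
    using e(2) by blast
qed

lemma occupies_append:
  assumes coh: "coherent h f" "coherent h u" "u \<in> h f (Suc k)"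
    and W: "insert d W \<subseteq> h u k" "W \<subseteq> {d<..}"
    and t: "occupies h k t d" "xi h k d = Suc (length t)"
  shows "occupies h k (t @ [W]) f"
proof -
  have sub: "h u k \<subseteq> h f (Suc k)"
    using coherent_mono[OF coh(2), of k "Suc k"] coherent_sub[OF coh(1,3)] by simp
  have "xi h k v = Suc (length t)" if "v \<in> W" for v
  proof -
    have "xi h k d \<le> xi h k v"
      using xi_mono[OF coherent_hull_closed[OF coh(1)], of d k v] sub W that
      by (auto intro: less_imp_le)
    then show ?thesis
      using coherent_xi[OF coh(2), of d k] coherent_xi[OF coh(2), of v k] W(1) that t(2) by auto
  qed
  moreover have "occupies h k t f"
    using occupies_upward[OF coh(1) _ t(1)] sub W(1) by blast
  ultimately show ?thesis
    using sub W(1) coherent_le[OF coh(1), of _ "Suc k"]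
    by (auto simp: occupies_def nth_append less_Suc_eq)
qed

lemma caught_by_append:
  assumes generic: "\<And>x. generic_hull T h x" and d: "caught_by h S d"
    and Z: "finite Z" "Z \<subseteq> {..<d}" and W: "finite W" "W \<noteq> {}" "W \<subseteq> {d<..}"
    and D: "\<And>x. x \<in> D \<Longrightarrow> \<exists>x'\<in>D. is_succ x x'" "W \<subseteq> D"
  obtains t k f y where "t \<in> S" "K < k" "f \<in> D" "full h f (Suc k)" "occupies h k (t @ [W]) f"
    "y \<in> h f (Suc k)" "r (Suc k) = card (h y k)" "reachable h Z K k y"
proof -
  have coh: "coherent h x" for x
    using generic generic_hull_coherent by blast
  define u where "u = Max W"
  have "u \<in> W"
    unfolding u_def using W(1,2) by (rule Max_in)
  moreover have "W \<subseteq> {..u}"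
    using W(1) by (auto simp: u_def)
  ultimately have W_u: "insert d W \<subseteq> {..u}"
    using W(3) by (auto intro: less_imp_le)
  obtain K' where K': "\<And>k. K' \<le> k \<Longrightarrow> insert d W \<subseteq> h u k"
    using coherent_subset_MOST[OF coh _ W_u] W(1) by (auto simp: MOST_nat_le)
  from d[unfolded caught_by_def, rule_format, of Z "max K K'"] Z
  obtain t k where t: "t \<in> S" "catches h t Z (max K K') d k"
    by blast
  then obtain y where y: "root_ends_at h y d k" "reachable h Z (max K K') k y"
    by (auto simp: catches_def)
  obtain f where f: "f \<in> D" "u \<in> h f (Suc k)" "full h f (Suc k)"
    using full_hull_exists[of D T h u "Suc k"] generic D \<open>u \<in> W\<close> by blast
  have k: "K < k" "insert d W \<subseteq> h u k" and xi_d: "xi h k d = Suc (length t)"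
      and occupies_d: "occupies h k t d"
    using t(2) K' by (auto simp: catches_def)
  have "y \<in> h f (Suc k)" "r (Suc k) = card (h y k)"
    using y(1) k(2) coherent_mono[OF coh, of k "Suc k" u] coherent_sub[OF coh f(2)]
      coherent_sub[OF coh, of d u k]
    by (auto simp: root_ends_at_def)
  moreover have "reachable h Z K k y"
    using y(2) by (auto simp: reachable_def)
  ultimately show ?thesis
    using that[OF t(1) k(1) f(1,3)] occupies_append[OF coh coh f(2) k(2) W(3) occupies_d xi_d]
    by blast
qed

lemma reachable_subset_root:
  assumes coh: "\<And>x. coherent h x"
    and y: "y \<in> h f (Suc k)" "r (Suc k) = card (h y k)" "reachable h Z K k y"
  shows "Z \<subseteq> piece h k (h f (Suc k)) 0"
proof
  fix z assume "z \<in> Z"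
  then obtain l where "l < k" "branches_off h z y l"
    using y(3) by (auto simp: reachable_def)
  then have z: "z \<in> h y k"
    using coherent_mono[OF coh, of l k y] by (auto simp: branches_off_def root_ends_at_def)
  have "xi h k y = 0"
    using xi_eq_0_iff[OF coh] y(2) by simp
  then have "xi h k z = 0"
    using coherent_xi[OF coh z] by simp
  moreover have "z \<in> h f (Suc k)"
    using z coherent_mono[OF coh, of k "Suc k" y] coherent_sub[OF coh y(1)] by auto
  ultimately show "z \<in> piece h k (h f (Suc k)) 0"
    by (simp add: piece_def)
qed

lemma catches_next_piece:
  assumes coh: "\<And>x. coherent h x" and f: "full h f (Suc k)" "occupies h k t f"
    and y: "y \<in> h f (Suc k)" "r (Suc k) = card (h y k)" "reachable h Z K k y"
    and "K < k" "length t < n (Suc k)"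
  shows "\<exists>e\<in>h f (Suc k). catches h t Z K e k"
proof -
  have "1 \<le> Suc (length t)" "Suc (length t) \<le> n (Suc k)"
    using \<open>length t < n (Suc k)\<close> by simp_all
  from full_piece[OF coh f(1) this]
  obtain e where e: "e \<in> h f (Suc k)" "xi h k e = Suc (length t)"
      "h e k = piece h k (h f (Suc k)) (Suc (length t))"
    by auto
  have "xi h k y = 0"
    using xi_eq_0_iff[OF coh] y(2) by simp
  moreover from this have "y < e"
    using xi_less_imp_less[OF coherent_hull_closed[OF coh] y(1) e(1)] e(2) by simp
  ultimately have "root_ends_at h y e k"
    using y(1,2) e(3) by (simp add: root_ends_at_def piece_def)
  moreover have "occupies h k t e"
    using occupies_restrict[OF coh f(2) e(1)] e(2) by simp
  ultimately have "catches h t Z K e k"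
    using e(2) y(3) \<open>K < k\<close> by (auto simp: catches_def)
  then show ?thesis
    using e(1) by blast
qed

lemma caught_below_append:
  assumes generic: "\<And>x. generic_hull T h x" and lim: "is_lim c" and n: "\<forall>\<^sub>\<infinity>k. Suc s < n k"
    and S: "\<And>x. x < c \<Longrightarrow> \<exists>d W S'. x < d \<and> caught_by h S' d \<and> finite W \<and> W \<noteq> {} \<and> W \<subseteq> {d<..<c} \<and>
      (\<forall>t\<in>S'. length t = s \<and> t @ [W] \<in> S)"
  shows "caught_below h S c"
  unfolding caught_below_def
proof (intro allI impI)
  fix Z K assume Z: "finite Z \<and> Z \<subseteq> {..<c}"
  have coh: "coherent h x" for x
    using generic generic_hull_coherent by blast
  obtain K' where K': "\<And>k. K' < k \<Longrightarrow> Suc s < n k"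
    using n unfolding MOST_nat by blast
  obtain x where x: "x < c" "Z \<subseteq> {..<x}"
    using is_lim_finite_bound[OF lim] Z by blast
  then obtain d W S' where "x < d" and d: "caught_by h S' d"
    and W: "finite W" "W \<noteq> {}" "W \<subseteq> {d<..<c}" and S': "\<forall>t\<in>S'. length t = s \<and> t @ [W] \<in> S"
    using S[OF x(1)] by blast
  have "Z \<subseteq> {..<d}" "W \<subseteq> {d<..}" "W \<subseteq> {..<c}"
    using x(2) \<open>x < d\<close> W(3) by (auto simp: subset_iff intro: less_trans)
  moreover have "\<exists>x'\<in>{..<c}. is_succ x x'" if "x \<in> {..<c}" for x
    using is_lim_succ_less[OF lim] that by auto
  ultimately obtain t k f y where t: "t \<in> S'" and k: "max K K' < k"
    and f: "f \<in> {..<c}" "full h f (Suc k)" "occupies h k (t @ [W]) f"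
    and y: "y \<in> h f (Suc k)" "r (Suc k) = card (h y k)" "reachable h Z (max K K') k y"
    using caught_by_append[OF generic d _ _ W(1,2), of Z "{..<c}" "max K K'"] Z by blast
  have "reachable h Z K k y" "K < k" "length (t @ [W]) < n (Suc k)"
    using y(3) k K'[of "Suc k"] S' t by (auto simp: reachable_def)
  then obtain e where e: "e \<in> h f (Suc k)" "catches h (t @ [W]) Z K e k"
    using catches_next_piece[OF coh f(2,3) y(1,2)] by blast
  moreover have "e < c"
    using coherent_le[OF coh e(1)] f(1) by simp
  ultimately show "\<exists>e<c. \<exists>k. \<exists>t\<in>S. catches h t Z K e k"
    using S' t by blast
qed

lemma caught_by_captured:
  fixes h :: "'a::wellorder hulls"
  assumes generic: "\<And>x. generic_hull T h x" and succ: "\<And>x::'a. \<exists>y. is_succ x y"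
    and d: "caught_by h S d" and S: "\<And>t. t \<in> S \<Longrightarrow> length t = s \<and> set t \<subseteq> tails \<S> R q" "s \<ge> 1"
    and R: "finite R" "R \<subseteq> {..<d}" and W: "W \<in> tails \<S> R q" "W \<subseteq> {d<..}" and "q > 0"
  shows "\<exists>l>K. \<exists>D. inj_on D {..<Suc s} \<and> D ` {..<Suc s} \<subseteq> \<S> \<and> rho_captured m n r (hull_family h) D (Suc s) l"
proof -
  have coh: "coherent h x" for x
    using generic generic_hull_coherent by blast
  have W': "finite W" "W \<noteq> {}"
    using W(1) \<open>q > 0\<close> by (auto simp: tails_def)
  have succ': "\<exists>y\<in>UNIV. is_succ x y" for x :: 'a
    using succ by simp
  obtain t k f y where t: "t \<in> S" and "K < k" and f: "full h f (Suc k)" "occupies h k (t @ [W]) f"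
    and y: "y \<in> h f (Suc k)" "r (Suc k) = card (h y k)" "reachable h R K k y"
    by (rule caught_by_append[OF generic d R W' W(2) succ' subset_UNIV, where K = K])
  let ?t = "t @ [W]"
  let ?D = "\<lambda>i. R \<union> ?t ! i"
  have t': "set ?t \<subseteq> tails \<S> R q" "2 \<le> length ?t" "length ?t = Suc s"
    using S t W(1) by auto
  have root: "R \<subseteq> piece h k (h f (Suc k)) 0"
    using reachable_subset_root[OF coh y] .
  have "rho_captured m n r (hull_family h) ?D (Suc s) (Suc k)"
    using rho_captured_hull[OF coh f t'(1,2) R(1) root \<open>q > 0\<close>] unfolding t'(3) .
  moreover have "inj_on ?D {..<Suc s}"
    using rtt_delta_inj_on[OF rtt_delta_hull[OF coh f(2) t'(1,2) R(1) root]] \<open>q > 0\<close> unfolding t'(3)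
    by simp
  moreover have "?D i \<in> \<S>" if "i < Suc s" for i
    using t'(1,3) that nth_mem[of i ?t] by (auto simp: tails_def)
  ultimately show ?thesis
    using \<open>K < k\<close> by (intro exI[of _ "Suc k"] conjI exI[of _ ?D]) auto
qed

end

text \<open>A guessed set \<open>U\<close> is read as the pair of the point \<open>Min U\<close> and a tail above it.\<close>

primrec guess_tuples :: "('a::wellorder \<Rightarrow> 'a set set) \<Rightarrow> nat \<Rightarrow> 'a \<Rightarrow> 'a set list set" where
  "guess_tuples \<D> 0 d = {[]}"
| "guess_tuples \<D> (Suc s) d = {t @ [U - {Min U}] | t U. U \<in> \<D> d \<and> t \<in> guess_tuples \<D> s (Min U)}"

locale omega1_type = omega1 ty + scheme_type m n r
  for ty :: "'a::wellorder itself" and m n r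
begin

definition tuples_caught :: "('a \<Rightarrow> 'a set set) \<Rightarrow> 'a hulls \<Rightarrow> 'a set set \<Rightarrow> nat \<Rightarrow> 'a \<Rightarrow> bool" where
  "tuples_caught \<D> h \<W> s d \<longleftrightarrow> caught_by h (guess_tuples \<D> s d) d \<and>
     (\<forall>t\<in>guess_tuples \<D> s d. length t = s \<and> set t \<subseteq> \<W>)"

lemma tuples_caught_Suc:
  assumes generic: "\<And>x::'a. generic_hull (guess_tuples \<D>) h x"
    and \<W>: "\<forall>W\<in>\<W>. finite W \<and> W \<noteq> {}" and n: "\<forall>\<^sub>\<infinity>k. Suc s < n k"
    and c: "is_lim c" "\<D> c \<subseteq> {insert d W | d W. tuples_caught \<D> h \<W> s d \<and> W \<in> \<W> \<and> W \<subseteq> {d<..}}"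
      "\<forall>x<c. \<exists>U\<in>\<D> c. U \<subseteq> {x<..<c}"
  shows "tuples_caught \<D> h \<W> (Suc s) c"
proof -
  have split: "tuples_caught \<D> h \<W> s (Min U)" "U - {Min U} \<in> \<W>" "U - {Min U} \<subseteq> {Min U<..}" "Min U \<in> U"
    if "U \<in> \<D> c" for U
  proof -
    obtain d W where U: "U = insert d W" "tuples_caught \<D> h \<W> s d" "W \<in> \<W>" "W \<subseteq> {d<..}"
      using \<open>U \<in> \<D> c\<close> c(2) by blast
    then have "Min U = d"
      using \<W> by (intro Min_eqI) (auto intro: less_imp_le)
    moreover have "U - {d} = W"
      using U(1,4) by auto
    ultimately show "tuples_caught \<D> h \<W> s (Min U)" "U - {Min U} \<in> \<W>" "U - {Min U} \<subseteq> {Min U<..}" "Min U \<in> U"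
      using U by auto
  qed
  have "caught_below h (guess_tuples \<D> (Suc s) c) c"
  proof (rule caught_below_append[OF generic c(1) n])
    fix x assume "x < c"
    then obtain U where U: "U \<in> \<D> c" "U \<subseteq> {x<..<c}"
      using c(3) by blast
    define d W where "d = Min U" and "W = U - {Min U}"
    have "x < d" "W \<subseteq> {d<..<c}"
      using split(3,4)[OF U(1)] U(2) by (auto simp: d_def W_def subset_iff)
    moreover have "caught_by h (guess_tuples \<D> s d) d"
      using split(1)[OF U(1)] by (simp add: d_def tuples_caught_def)
    moreover have "finite W" "W \<noteq> {}"
      using bspec[OF \<W> split(2)[OF U(1)]] by (simp_all add: W_def)
    moreover have "\<forall>t\<in>guess_tuples \<D> s d. length t = s \<and> t @ [W] \<in> guess_tuples \<D> (Suc s) c"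
      using split(1)[OF U(1)] U(1) unfolding tuples_caught_def d_def W_def guess_tuples.simps by blast
    ultimately show "\<exists>d W S'. x < d \<and> caught_by h S' d \<and> finite W \<and> W \<noteq> {} \<and> W \<subseteq> {d<..<c} \<and>
        (\<forall>t\<in>S'. length t = s \<and> t @ [W] \<in> guess_tuples \<D> (Suc s) c)"
      by blast
  qed
  then have "caught_by h (guess_tuples \<D> (Suc s) c) c"
    by (rule generic_hull_caught[OF generic c(1)])
  moreover have "length t = Suc s \<and> set t \<subseteq> \<W>" if "t \<in> guess_tuples \<D> (Suc s) c" for t
    using that split(1,2) by (fastforce simp: tuples_caught_def)
  ultimately show ?thesis
    by (simp add: tuples_caught_def)
qed

lemma tuples_caught_unbounded:
  assumes \<D>: "guesses_finite_sets \<D>" and generic: "\<And>x::'a. generic_hull (guess_tuples \<D>) h x"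
    and \<W>: "unbounded_family \<W>" "\<forall>W\<in>\<W>. finite W \<and> W \<noteq> {}" and n: "\<forall>\<^sub>\<infinity>k. s < n k"
  shows "\<exists>d>b. tuples_caught \<D> h \<W> s d"
  using n
proof (induction s arbitrary: b)
  case 0
  obtain d where d: "b < d" "is_lim d"
    using closure_point_exists[of b id] by blast
  then have "caught_below h (guess_tuples \<D> 0 d) d"
    using caught_below_Nil[OF d(2) generic] by simp
  then have "tuples_caught \<D> h \<W> 0 d"
    using generic_hull_caught[OF generic d(2), of 0] by (simp add: tuples_caught_def)
  then show ?case
    using d(1) by blast
next
  case (Suc s)
  define \<U> where "\<U> = {insert d W | d W. tuples_caught \<D> h \<W> s d \<and> W \<in> \<W> \<and> W \<subseteq> {d<..}}"
  have "\<forall>\<^sub>\<infinity>k. s < n k"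
    using Suc.prems by (rule MOST_mono) simp
  note IH = Suc.IH[OF this]
  have "\<exists>U\<in>\<U>. U \<subseteq> {x<..}" for x
  proof -
    obtain d where d: "x < d" "tuples_caught \<D> h \<W> s d"
      using IH[of x] by blast
    obtain W where W: "W \<in> \<W>" "W \<subseteq> {d<..}"
      using \<W>(1) unfolding unbounded_family_def by blast
    have "insert d W \<subseteq> {x<..}"
      using d(1) W(2) by (auto intro: less_trans)
    then show ?thesis
      using d(2) W unfolding \<U>_def by blast
  qed
  moreover have "\<forall>U\<in>\<U>. finite U \<and> U \<noteq> {}"
    using \<W>(2) by (auto simp: \<U>_def)
  ultimately obtain c where c: "b < c" "is_lim c" "\<D> c \<subseteq> \<U>" "\<forall>x<c. \<exists>U\<in>\<D> c. U \<subseteq> {x<..<c}"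
    using \<D> unfolding guesses_finite_sets_def unbounded_family_def by metis
  then show ?case
    using tuples_caught_Suc[OF generic \<W>(2) Suc.prems, of c] unfolding \<U>_def by blast
qed

lemma n_rho_capturing_hull_family:
  assumes \<D>: "guesses_finite_sets \<D>" and generic: "\<And>x::'a. generic_hull (guess_tuples \<D>) h x"
    and len: "len \<ge> 2" and n: "\<forall>\<^sub>\<infinity>k. len \<le> n k"
  shows "n_rho_capturing len m n r (hull_family h)"
  unfolding n_rho_capturing_def
proof (intro allI impI)
  fix \<S> :: "'a set set" assume "uncountable \<S> \<and> (\<forall>S\<in>\<S>. S \<noteq> {} \<and> finite S)"
  then obtain R q where R: "finite R" "q > 0" and unbounded: "unbounded_family (tails \<S> R q)"
    using delta_system[of \<S>] by blast
  have tails: "\<forall>W\<in>tails \<S> R q. finite W \<and> W \<noteq> {}"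
    using R(2) by (auto simp: tails_def)
  obtain s where s: "len = Suc s" "s \<ge> 1"
    using len by (cases len) auto
  obtain x where x: "R \<subseteq> {..<x}"
    using countable_bounded[of R] R(1) countable_finite by blast
  have "\<forall>\<^sub>\<infinity>k. s < n k"
    using n by (simp add: s(1) Suc_le_eq)
  from tuples_caught_unbounded[OF \<D> generic unbounded tails this, of x]
  obtain d where d: "x < d" "caught_by h (guess_tuples \<D> s d) d"
    "\<And>t. t \<in> guess_tuples \<D> s d \<Longrightarrow> length t = s \<and> set t \<subseteq> tails \<S> R q"
    unfolding tuples_caught_def by blast
  obtain W where W: "W \<in> tails \<S> R q" "W \<subseteq> {d<..}"
    using unbounded unfolding unbounded_family_def by blast
  have "R \<subseteq> {..<d}"
    using x d(1) by (auto intro: less_trans)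
  from caught_by_captured[OF generic is_succ_total d(2,3) s(2) R(1) this W R(2)]
  show "infinite {l. \<exists>D. inj_on D {..<len} \<and> D ` {..<len} \<subseteq> \<S> \<and> rho_captured m n r (hull_family h) D len l}"
    unfolding s(1) infinite_nat_iff_unbounded by blast
qed

end

theorem clubsuit_capturing_scheme_exists:
  assumes "omega1_like TYPE('a::wellorder)" "clubsuit TYPE('a)" and good: "good_type m n r"
  shows "\<exists>\<F> :: 'a set set. construction_scheme m n r UNIV \<F> \<and>
    (\<forall>len\<ge>2. (\<forall>\<^sub>\<infinity>k. len \<le> n k) \<longrightarrow> n_rho_capturing len m n r \<F>)"
proof -
  interpret omega1_type "TYPE('a)" m n r
    using assms by unfold_locales (simp_all add: good_type_def)
  obtain \<D> :: "'a \<Rightarrow> 'a set set" where \<D>: "guesses_finite_sets \<D>"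
    using clubsuit_guesses_finite_sets[OF assms(2)] ..
  obtain h where generic: "\<And>x::'a. generic_hull (guess_tuples \<D>) h x"
    using generic_hulls_exist[OF good countable_lessThan] by blast
  show ?thesis
    using construction_scheme_hull_family[OF generic is_succ_total] n_rho_capturing_hull_family[OF \<D> generic]
    by blast
qed

theorem mainTheorem9:
  assumes "omega1_like TYPE('a::wellorder)"
    and "clubsuit TYPE('a)"
  shows "(\<forall>len m n r. len \<ge> 2 \<and> good_type m n r \<and> (\<forall>k\<ge>1. n k \<ge> len) \<longrightarrow>
            (\<exists>\<F> :: 'a set set. construction_scheme m n r UNIV \<F> \<and> n_rho_capturing len m n r \<F>))
       \<and> (\<forall>m n r. good_type m n r \<and> mono (\<lambda>k. n (Suc k)) \<and> (\<forall>b. \<exists>k. n (Suc k) > b) \<longrightarrow>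
            (\<exists>\<F> :: 'a set set. construction_scheme m n r UNIV \<F> \<and> rho_capturing m n r \<F>))"
proof (intro conjI allI impI)
  fix len :: nat and m n r :: "nat \<Rightarrow> nat"
  assume len: "len \<ge> 2 \<and> good_type m n r \<and> (\<forall>k\<ge>1. n k \<ge> len)"
  then have "\<forall>\<^sub>\<infinity>k. len \<le> n k"
    unfolding MOST_nat_le by blast
  with len show "\<exists>\<F> :: 'a set set. construction_scheme m n r UNIV \<F> \<and> n_rho_capturing len m n r \<F>"
    using clubsuit_capturing_scheme_exists[OF assms, of m n r] by blast
next
  fix m n r :: "nat \<Rightarrow> nat"
  assume type: "good_type m n r \<and> mono (\<lambda>k. n (Suc k)) \<and> (\<forall>b. \<exists>k. n (Suc k) > b)"
  then have "\<forall>\<^sub>\<infinity>k. len \<le> n (Suc k)" for len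
    using mono_unbounded_MOST_le by blast
  then have "\<forall>\<^sub>\<infinity>k. len \<le> n k" for len
    by (rule MOST_SucD)
  with type show "\<exists>\<F> :: 'a set set. construction_scheme m n r UNIV \<F> \<and> rho_capturing m n r \<F>"
    using clubsuit_capturing_scheme_exists[OF assms, of m n r] unfolding rho_capturing_def by blast
qed

end
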